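(* Let $0<\alpha<1$. Then $H_{\alpha}^{0}$ is a proper $M$-ideal in $H_{\alpha}^{\omega}$; that is, $H_\alpha^0$ is an $M$-ideal in $H_\alpha^\omega$ but is not an $M$-summand in $H_\alpha^\omega$.
   Context: Scalars are real or complex. For $0<\alpha<1$, $H_\alpha$ is the Banach space of all scalar-valued functions $f$ on $[0,1]$ with $f(0)=0$ and $L(f)=\sup_{x\ne y}\frac{|f(x)-f(y)|}{|x-y|^\alpha}<\infty$, normed by $L(\cdot)$. $H_\alpha^0$ is the closed subspace of all $f\in H_\alpha$ such that $\lim_{|x-y|\to 0,\,x\ne y}\frac{|f(x)-f(y)|}{|x-y|^\alpha}=0$ (uniformly). $H_\alpha^\omega$ is the (closed) subspace of all $h\in H_\alpha$ with the following property: for any $\varepsilon>0$ there are finitely many points $x_1,\dots,x_n\in[0,1]$ such that every $\tilde x\in[0,1]\setminus\{x_1,\dots,x_n\}$ has a neighbourhood $U(\tilde x)$ (in $[0,1]$) with $\sup_{x,y\in U(\tilde x),\,x\neq y}\frac{|h(x)-h(y)|}{|x-y|^\alpha}\le\varepsilon$. It carries the norm $L(\cdot)$. Let $X$ be a Banach space. A linear projection $P$ on $X$ is an $M$-projection if $\|x\|=\max(\|P(x)\|,\|x-P(x)\|)$ for all $x\in X$, and an $L$-projection if $\|x\|=\|P(x)\|+\|x-P(x)\|$ for all $x\in X$. A closed subspace of $X$ is an $M$-summand (resp. $L$-summand) if it is the range of an $M$-projection (resp. $L$-projection). A closed subspace $U\subset X$ is an $M$-ideal in $X$ if its annihilator $U^\perp$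 is an $L$-summand in the dual $X'$; it is a proper $M$-ideal if moreover it is not an $M$-summand. *)

theory Defs
  imports "HOL-Analysis.Analysis" "HOL-Library.Function_Algebras"
begin

text \<open>
  The spaces below depend on a real parameter, so they are carrier sets \<open>X\<close> in an ambient
  vector space with scalar multiplication \<open>s\<close>, normed by a function \<open>N\<close> that is only
  meaningful on \<open>X\<close>. The scalar field \<open>'k\<close> is later instantiated to \<open>real\<close> and \<open>complex\<close>.
\<close>

locale normed_space_on = vector_space s
  for s :: "'k::real_normed_field \<Rightarrow> 'v::ab_group_add \<Rightarrow> 'v" +
  fixes X :: "'v set" and N :: "'v \<Rightarrow> real"
  assumes subspace_carrier: "module.subspace s X"
    and norm_nonneg: "x \<in> X \<Longrightarrow> 0 \<le> N x"
    and norm_eq_0_iff: "x \<in> X \<Longrightarrow> N x = 0 \<longleftrightarrow> x = 0"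
    and norm_scale: "x \<in> X \<Longrightarrow> N (s c x) = norm c * N x"
    and norm_triangle: "x \<in> X \<Longrightarrow> y \<in> X \<Longrightarrow> N (x + y) \<le> N x + N y"

text \<open>Set to 0 off the carrier because \<^locale>\<open>Metric_space\<close> requires non-negativity and
  symmetry for all arguments, not only for points of the carrier.\<close>

definition norm_dist :: "'v::ab_group_add set \<Rightarrow> ('v \<Rightarrow> real) \<Rightarrow> 'v \<Rightarrow> 'v \<Rightarrow> real" where
  "norm_dist X N x y = (if x \<in> X \<and> y \<in> X then N (x - y) else 0)"

locale banach_space_on = normed_space_on +
  assumes complete: "Metric_space.mcomplete X (norm_dist X N)"

definition closed_subspace_on ::
  "('k::real_normed_field \<Rightarrow> 'v::ab_group_add \<Rightarrow> 'v) \<Rightarrow> 'v set \<Rightarrow> ('v \<Rightarrow> real) \<Rightarrow> 'v set \<Rightarrow> bool" where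
  "closed_subspace_on s X N U \<longleftrightarrow>
     module.subspace s U \<and> closedin (Metric_space.mtopology X (norm_dist X N)) U"

lemma (in normed_space_on) Metric_space_norm_dist: "Metric_space X (norm_dist X N)"
proof
  have sub: "x - y \<in> X" if "x \<in> X" "y \<in> X" for x y
    using that subspace_carrier by (simp add: subspace_diff)
  fix x y z
  show "0 \<le> norm_dist X N x y"
    by (simp add: norm_dist_def norm_nonneg sub)
  have "N (x - y) = N (y - x)" if "x \<in> X" "y \<in> X"
    using norm_scale[OF sub[OF that], of "-1"] by simp
  then show "norm_dist X N x y = norm_dist X N y x"
    by (simp add: norm_dist_def)
  assume xy: "x \<in> X" "y \<in> X"
  then show "norm_dist X N x y = 0 \<longleftrightarrow> x = y"
    by (simp add: norm_dist_def norm_eq_0_iff sub)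
  assume z: "z \<in> X"
  show "norm_dist X N x z \<le> norm_dist X N x y + norm_dist X N y z"
    using norm_triangle[OF sub[OF xy] sub[OF xy(2) z]] xy z by (simp add: norm_dist_def)
qed

definition fun_scale :: "'k::times \<Rightarrow> ('p \<Rightarrow> 'k) \<Rightarrow> 'p \<Rightarrow> 'k" where
  "fun_scale c f = (\<lambda>x. c * f x)"

lemma vector_space_fun_scale:
  "vector_space (fun_scale :: 'k::field \<Rightarrow> ('p \<Rightarrow> 'k) \<Rightarrow> 'p \<Rightarrow> 'k)"
  by unfold_locales (auto simp: fun_scale_def fun_eq_iff algebra_simps)

text \<open>A functional on \<open>X\<close> is represented by its extension by 0 outside \<open>X\<close>, so that distinct
  elements of the dual are distinct functions; the dual is a vector space under pointwise
  addition and \<^const>\<open>fun_scale\<close>.\<close>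

definition dual_on ::
  "('k::real_normed_field \<Rightarrow> 'v::ab_group_add \<Rightarrow> 'v) \<Rightarrow> 'v set \<Rightarrow> ('v \<Rightarrow> real) \<Rightarrow> ('v \<Rightarrow> 'k) set" where
  "dual_on s X N = {\<phi>.
     (\<forall>x. x \<notin> X \<longrightarrow> \<phi> x = 0) \<and>
     (\<forall>x\<in>X. \<forall>y\<in>X. \<phi> (x + y) = \<phi> x + \<phi> y) \<and>
     (\<forall>c. \<forall>x\<in>X. \<phi> (s c x) = c * \<phi> x) \<and>
     (\<exists>B. \<forall>x\<in>X. norm (\<phi> x) \<le> B * N x)}"

definition dual_norm_on ::
  "'v set \<Rightarrow> ('v \<Rightarrow> real) \<Rightarrow> ('v \<Rightarrow> 'k::real_normed_field) \<Rightarrow> real" where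
  "dual_norm_on X N \<phi> = (SUP x\<in>{x\<in>X. N x \<le> 1}. norm (\<phi> x))"

definition annihilator_on ::
  "('k::real_normed_field \<Rightarrow> 'v::ab_group_add \<Rightarrow> 'v) \<Rightarrow> 'v set \<Rightarrow> ('v \<Rightarrow> real) \<Rightarrow> 'v set \<Rightarrow> ('v \<Rightarrow> 'k) set" where
  "annihilator_on s X N U = {\<phi> \<in> dual_on s X N. \<forall>x\<in>U. \<phi> x = 0}"

definition linear_projection_on ::
  "('k::real_normed_field \<Rightarrow> 'v::ab_group_add \<Rightarrow> 'v) \<Rightarrow> 'v set \<Rightarrow> ('v \<Rightarrow> 'v) \<Rightarrow> bool" where
  "linear_projection_on s X P \<longleftrightarrow>
     (\<forall>x\<in>X. P x \<in> X) \<and>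
     (\<forall>x\<in>X. \<forall>y\<in>X. P (x + y) = P x + P y) \<and>
     (\<forall>c. \<forall>x\<in>X. P (s c x) = s c (P x)) \<and>
     (\<forall>x\<in>X. P (P x) = P x)"

definition M_projection ::
  "('k::real_normed_field \<Rightarrow> 'v::ab_group_add \<Rightarrow> 'v) \<Rightarrow> 'v set \<Rightarrow> ('v \<Rightarrow> real) \<Rightarrow> ('v \<Rightarrow> 'v) \<Rightarrow> bool" where
  "M_projection s X N P \<longleftrightarrow>
     linear_projection_on s X P \<and> (\<forall>x\<in>X. N x = max (N (P x)) (N (x - P x)))"

definition L_projection ::
  "('k::real_normed_field \<Rightarrow> 'v::ab_group_add \<Rightarrow> 'v) \<Rightarrow> 'v set \<Rightarrow> ('v \<Rightarrow> real) \<Rightarrow> ('v \<Rightarrow> 'v) \<Rightarrow> bool" where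
  "L_projection s X N P \<longleftrightarrow>
     linear_projection_on s X P \<and> (\<forall>x\<in>X. N x = N (P x) + N (x - P x))"

definition M_summand ::
  "('k::real_normed_field \<Rightarrow> 'v::ab_group_add \<Rightarrow> 'v) \<Rightarrow> 'v set \<Rightarrow> ('v \<Rightarrow> real) \<Rightarrow> 'v set \<Rightarrow> bool" where
  "M_summand s X N U \<longleftrightarrow>
     closed_subspace_on s X N U \<and> (\<exists>P. M_projection s X N P \<and> P ` X = U)"

definition L_summand ::
  "('k::real_normed_field \<Rightarrow> 'v::ab_group_add \<Rightarrow> 'v) \<Rightarrow> 'v set \<Rightarrow> ('v \<Rightarrow> real) \<Rightarrow> 'v set \<Rightarrow> bool" where
  "L_summand s X N U \<longleftrightarrow>
     closed_subspace_on s X N U \<and> (\<exists>P. L_projection s X N P \<and> P ` X = U)"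

definition M_ideal ::
  "('k::real_normed_field \<Rightarrow> 'v::ab_group_add \<Rightarrow> 'v) \<Rightarrow> 'v set \<Rightarrow> ('v \<Rightarrow> real) \<Rightarrow> 'v set \<Rightarrow> bool" where
  "M_ideal s X N U \<longleftrightarrow>
     banach_space_on s X N \<and> closed_subspace_on s X N U \<and>
     L_summand fun_scale (dual_on s X N) (dual_norm_on X N) (annihilator_on s X N U)"

definition proper_M_ideal ::
  "('k::real_normed_field \<Rightarrow> 'v::ab_group_add \<Rightarrow> 'v) \<Rightarrow> 'v set \<Rightarrow> ('v \<Rightarrow> real) \<Rightarrow> 'v set \<Rightarrow> bool" where
  "proper_M_ideal s X N U \<longleftrightarrow> M_ideal s X N U \<and> \<not> M_summand s X N U"

definition holder_quot :: "real \<Rightarrow> (real \<Rightarrow> 'k::real_normed_field) \<Rightarrow> real \<Rightarrow> real \<Rightarrow> real" where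
  "holder_quot \<alpha> f x y = norm (f x - f y) / \<bar>x - y\<bar> powr \<alpha>"

definition holder_quots :: "real \<Rightarrow> (real \<Rightarrow> 'k::real_normed_field) \<Rightarrow> real set" where
  "holder_quots \<alpha> f = {holder_quot \<alpha> f x y | x y. x \<in> {0..1} \<and> y \<in> {0..1} \<and> x \<noteq> y}"

definition holder_norm :: "real \<Rightarrow> (real \<Rightarrow> 'k::real_normed_field) \<Rightarrow> real" where
  "holder_norm \<alpha> f = Sup (holder_quots \<alpha> f)"

text \<open>Functions on the unit interval are represented by their extension by 0 to the real line.\<close>

definition holder_space :: "real \<Rightarrow> (real \<Rightarrow> 'k::real_normed_field) set" where
  "holder_space \<alpha> =
     {f. (\<forall>x. x \<notin> {0..1} \<longrightarrow> f x = 0) \<and> f 0 = 0 \<and> bdd_above (holder_quots \<alpha> f)}"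

definition little_holder_space :: "real \<Rightarrow> (real \<Rightarrow> 'k::real_normed_field) set" where
  "little_holder_space \<alpha> = {f \<in> holder_space \<alpha>.
     \<forall>\<epsilon>>0. \<exists>\<delta>>0. \<forall>x\<in>{0..1}. \<forall>y\<in>{0..1}.
       x \<noteq> y \<and> \<bar>x - y\<bar> < \<delta> \<longrightarrow> holder_quot \<alpha> f x y < \<epsilon>}"

definition omega_holder_space :: "real \<Rightarrow> (real \<Rightarrow> 'k::real_normed_field) set" where
  "omega_holder_space \<alpha> = {h \<in> holder_space \<alpha>.
     \<forall>\<epsilon>>0. \<exists>F. finite F \<and> F \<subseteq> {0..1} \<and>
       (\<forall>t\<in>{0..1} - F. \<exists>U. openin (top_of_set {0..1}) U \<and> t \<in> U \<and>
          (\<forall>x\<in>U. \<forall>y\<in>U. x \<noteq> y \<longrightarrow> holder_quot \<alpha> h x y \<le> \<epsilon>))}"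

end

theory Submission
  imports Defs
begin

text \<open>
  Write \<open>X\<close> for the large space, \<open>U\<close> for the little Hoelder space and \<open>L\<close> for the Hoelder norm. The
  whole argument rests on the operators \<open>T\<^sub>n\<close> (\<open>smooth n\<close>) that replace \<open>f\<close> by its running average over
  windows of length \<open>2\<^sup>-\<^sup>n\<close>. They are linear contractions into \<open>U\<close>, and \<open>T\<^sub>n u\<close> converges to \<open>u\<close> in norm
  for \<open>u \<in> U\<close>, but only uniformly, not in norm, for general functions.

  Consider first the M-ideal property. For a functional \<open>\<phi>\<close> on \<open>X\<close>, the values \<open>\<phi> (T\<^sub>n f)\<close> converge, and their limit \<open>\<Lambda>\<phi>\<close> is a
  functional that agrees with \<open>\<phi>\<close> on \<open>U\<close> and depends only on \<open>\<phi>\<close> restricted to \<open>U\<close>. Hence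
  \<open>\<phi> \<mapsto> \<phi> - \<Lambda>\<phi>\<close> is a projection onto the annihilator of \<open>U\<close>. It is an L-projection as soon as
  \<open>|\<Lambda>\<phi> f + (\<phi> - \<Lambda>\<phi>) g| \<le> \<parallel>\<phi>\<parallel>\<close> for \<open>f, g\<close> in the unit ball. The left-hand side is the limit of
  \<open>\<phi> (T\<^sub>n f + g - T\<^sub>n g)\<close>, so it suffices that averages of \<open>T\<^sub>n f + (g - T\<^sub>n g)\<close> over finitely many
  consecutive \<open>n\<close> have norm at most slightly above 1.

  To see this, fix two points at distance \<open>d\<close>. If \<open>2\<^sup>-\<^sup>n\<close> is much larger than \<open>d\<close>, then the
  increments of \<open>T\<^sub>n f\<close> and \<open>T\<^sub>n g\<close> are negligible compared with \<open>d\<^sup>\<alpha>\<close> and the increment of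
  \<open>T\<^sub>n f + (g - T\<^sub>n g)\<close> is close to that of \<open>g\<close>; if \<open>2\<^sup>-\<^sup>n\<close> is much smaller than \<open>d\<close>, then it is close to
  that of \<open>f\<close>. The errors decay geometrically in both directions away from the scale \<open>d\<close>, so their
  sum over all \<open>n\<close> is bounded independently of \<open>d\<close> and vanishes after averaging over many scales
  (\<open>mix_term_coarse\<close>, \<open>mix_term_fine\<close>, \<open>smooth_mix\<close>).

  Convergence of \<open>\<phi> (T\<^sub>n f)\<close> uses a similar separation of scales: if \<open>u \<in> U\<close> almost attains the norm
  of \<open>\<phi>\<close> on \<open>U\<close>, then \<open>u\<close> has small difference quotients at small distances, whereas \<open>T\<^sub>m f - T\<^sub>n f\<close>
  has small ones at large distances once \<open>m\<close> and \<open>n\<close> are large. So adding this difference to \<open>u\<close> hardly increases the norm, and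
  \<open>\<phi>\<close> must be small on it (\<open>smooth_tail\<close>, \<open>functional_T_convergent_small\<close>).

  That \<open>U\<close> is not an M-summand is seen from the function \<open>t \<mapsto> t\<^sup>\<alpha>\<close>, which lies in \<open>X\<close> but not in \<open>U\<close>. If \<open>U\<close> were an
  M-summand, a nonzero \<open>v\<close> of norm \<open>l\<close> in the complement would satisfy \<open>L(u + v) \<le> l\<close> for all
  \<open>u \<in> U\<close> of norm at most \<open>l\<close>. But scaled smoothings of \<open>t\<^sup>\<alpha>\<close> have norm at most \<open>l\<close>, and
  between \<open>0\<close> and a point \<open>y\<close> with \<open>v y \<noteq> 0\<close> their difference quotient comes arbitrarily close to \<open>l\<close>,
  with a phase that can be adjusted to that of \<open>v y\<close>: a contradiction.
\<close>

section \<open>Normed spaces, their duals and M-summands\<close>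

text \<open>
  Lets a sum of two absolute values be estimated as the absolute value of a single expression that is
  linear in both entries, over either scalar field.
\<close>

lemma norm_add_rotated:
  fixes a b :: "'k::real_normed_field"
  shows "\<exists>c d. norm c = 1 \<and> norm d = 1 \<and> norm (c * a + d * b) = norm a + norm b"
proof -
  have rot: "\<exists>c. norm c = 1 \<and> c * a = of_real (norm a)" for a :: 'k
  proof (cases "a = 0")
    case True
    then show ?thesis by (intro exI[of _ 1]) simp
  next
    case False
    then show ?thesis
      by (intro exI[of _ "of_real (norm a) / a"]) (simp add: norm_divide)
  qed
  obtain c d where "norm c = 1" "c * a = of_real (norm a)" "norm d = 1" "d * b = of_real (norm b)"
    using rot by meson
  moreover have "norm (of_real (norm a) + of_real (norm b) :: 'k) = norm a + norm b"
    by (simp flip: of_real_add)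
  ultimately show ?thesis by metis
qed

context normed_space_on
begin

lemma carrier_closed [simp]:
  "0 \<in> X" "x \<in> X \<Longrightarrow> y \<in> X \<Longrightarrow> x + y \<in> X" "x \<in> X \<Longrightarrow> y \<in> X \<Longrightarrow> x - y \<in> X" "x \<in> X \<Longrightarrow> s c x \<in> X"
  using subspace_carrier subspace_0 subspace_add subspace_diff subspace_scale by auto

lemma norm_minus_commute_on: "x \<in> X \<Longrightarrow> y \<in> X \<Longrightarrow> N (x - y) = N (y - x)"
  using norm_scale[of "x - y" "-1"] by simp

text \<open>
  Reduces closedness to approximation in norm, which for Hoelder functions is a statement about
  difference quotients.
\<close>

lemma closedin_iff_approximable:
  "closedin (Metric_space.mtopology X (norm_dist X N)) U \<longleftrightarrow>
     U \<subseteq> X \<and> (\<forall>x\<in>X. (\<forall>\<epsilon>>0. \<exists>u\<in>U. N (x - u) < \<epsilon>) \<longrightarrow> x \<in> U)"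
proof -
  interpret Metric_space X "norm_dist X N"
    by (rule Metric_space_norm_dist)
  have "disjnt U (mball x r) \<longleftrightarrow> (\<forall>u\<in>U. \<not> N (x - u) < r)" if "U \<subseteq> X" "x \<in> X" for x r
    using that by (auto simp: disjnt_iff norm_dist_def)
  then show ?thesis
    unfolding closedin_metric by (metis DiffD1 DiffD2 DiffI)
qed

lemma mcompleteI:
  assumes "\<And>f :: nat \<Rightarrow> 'v. range f \<subseteq> X \<Longrightarrow> (\<And>\<epsilon>. \<epsilon> > 0 \<Longrightarrow> \<exists>M. \<forall>m\<ge>M. \<forall>n\<ge>M. N (f m - f n) < \<epsilon>) \<Longrightarrow>
    \<exists>x\<in>X. \<forall>\<epsilon>>0. \<exists>M. \<forall>n\<ge>M. N (f n - x) < \<epsilon>"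
  shows "Metric_space.mcomplete X (norm_dist X N)"
proof -
  interpret Metric_space X "norm_dist X N"
    by (rule Metric_space_norm_dist)
  show ?thesis
    unfolding mcomplete_def
  proof (intro allI impI)
    fix f assume "MCauchy f"
    then have f: "range f \<subseteq> X"
      by (simp add: MCauchy_def)
    have cau: "\<exists>M. \<forall>m n. M \<le> m \<longrightarrow> M \<le> n \<longrightarrow> norm_dist X N (f m) (f n) < \<epsilon>" if "\<epsilon> > 0" for \<epsilon>
      using \<open>MCauchy f\<close> that by (simp add: MCauchy_def)
    have fX: "f n \<in> X" for n using f by auto
    have "\<exists>M. \<forall>m\<ge>M. \<forall>n\<ge>M. N (f m - f n) < \<epsilon>" if "\<epsilon> > 0" for \<epsilon>
      using cau[OF that] fX by (auto simp: norm_dist_def)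
    then obtain x where x: "x \<in> X" "\<forall>\<epsilon>>0. \<exists>M. \<forall>n\<ge>M. N (f n - x) < \<epsilon>"
      using assms[OF f] by blast
    then have "limitin mtopology f x sequentially"
      unfolding limit_metric_sequentially using fX by (simp add: norm_dist_def)
    then show "\<exists>x. limitin mtopology f x sequentially" ..
  qed
qed

text \<open>
  The vector is \<open>f - P f\<close> for an M-projection \<open>P\<close> onto \<open>U\<close> and any \<open>f\<close> outside \<open>U\<close>: it is
  annihilated by \<open>P\<close>, so \<open>P\<close> splits \<open>u + v\<close> into \<open>u\<close> and \<open>v\<close>.
\<close>

lemma M_summand_complement:
  assumes "M_summand s X N U" and "U \<noteq> X"
  shows "\<exists>v\<in>X. v \<noteq> 0 \<and> (\<forall>u\<in>U. N (u + v) \<le> max (N u) (N v))"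
proof -
  obtain P where P: "linear_projection_on s X P" "P ` X = U"
    and max: "\<And>x. x \<in> X \<Longrightarrow> N x = max (N (P x)) (N (x - P x))"
    using assms(1) unfolding M_summand_def M_projection_def by blast
  have into: "P x \<in> X" and idem: "P (P x) = P x" if "x \<in> X" for x
    using P(1) that by (auto simp: linear_projection_on_def)
  have add: "P (x + y) = P x + P y" if "x \<in> X" "y \<in> X" for x y
    using P(1) that by (auto simp: linear_projection_on_def)
  have fixed: "P u = u" and UX: "u \<in> X" if "u \<in> U" for u
    using that P(2) idem into by auto
  obtain f where f: "f \<in> X" "f \<notin> U"
    using assms(2) UX by blast
  define v where "v = f - P f"
  have v: "v \<in> X" using f into by (simp add: v_def)
  have "P f = P v + P (P f)" using add[OF v into[OF f(1)]] by (simp add: v_def)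
  then have Pv: "P v = 0" using idem f by simp
  have "P f \<in> U" using f P(2) by blast
  then have "v \<noteq> 0" using f(2) by (auto simp: v_def)
  moreover have "N (u + v) \<le> max (N u) (N v)" if "u \<in> U" for u
    using max[of "u + v"] add[of u v] fixed[OF that] Pv UX[OF that] v by simp
  ultimately show ?thesis using v by blast
qed

lemma dual_onD:
  assumes "\<phi> \<in> dual_on s X N"
  shows "x \<notin> X \<Longrightarrow> \<phi> x = 0"
    and "x \<in> X \<Longrightarrow> y \<in> X \<Longrightarrow> \<phi> (x + y) = \<phi> x + \<phi> y"
    and "x \<in> X \<Longrightarrow> \<phi> (s c x) = c * \<phi> x"
    and "\<phi> 0 = 0"
    and "x \<in> X \<Longrightarrow> y \<in> X \<Longrightarrow> \<phi> (x - y) = \<phi> x - \<phi> y"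
proof -
  show add: "x \<in> X \<Longrightarrow> y \<in> X \<Longrightarrow> \<phi> (x + y) = \<phi> x + \<phi> y" for x y
    using assms by (auto simp: dual_on_def)
  show "x \<notin> X \<Longrightarrow> \<phi> x = 0" and "x \<in> X \<Longrightarrow> \<phi> (s c x) = c * \<phi> x"
    using assms by (auto simp: dual_on_def)
  show "\<phi> 0 = 0"
    using add[of 0 0] by simp
  show "x \<in> X \<Longrightarrow> y \<in> X \<Longrightarrow> \<phi> (x - y) = \<phi> x - \<phi> y"
    using add[of "x - y" y] by simp
qed

lemma dual_on_sum:
  assumes "\<phi> \<in> dual_on s X N" "\<And>i. i \<in> I \<Longrightarrow> f i \<in> X"
  shows "\<phi> (sum f I) = (\<Sum>i\<in>I. \<phi> (f i)) \<and> sum f I \<in> X"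
  using assms(2)
proof (induction I rule: infinite_finite_induct)
  case (insert i I)
  then show ?case using dual_onD(2)[OF assms(1)] by auto
qed (use dual_onD(4)[OF assms(1)] in auto)

lemma dual_norm_on_least:
  assumes "\<And>x. x \<in> X \<Longrightarrow> N x \<le> 1 \<Longrightarrow> norm (\<phi> x) \<le> B"
  shows "dual_norm_on X N \<phi> \<le> B"
proof -
  have "0 \<in> {x \<in> X. N x \<le> 1}" using norm_eq_0_iff[of 0] by simp
  then show ?thesis
    unfolding dual_norm_on_def using assms by (intro cSUP_least) blast+
qed

lemma bdd_above_dual:
  assumes "\<phi> \<in> dual_on s X N"
  shows "bdd_above ((\<lambda>x. norm (\<phi> x)) ` {x \<in> X. N x \<le> 1})"
proof -
  obtain B where B: "\<And>x. x \<in> X \<Longrightarrow> norm (\<phi> x) \<le> B * N x"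
    using assms unfolding dual_on_def by blast
  have "norm (\<phi> x) \<le> \<bar>B\<bar>" if "x \<in> X" "N x \<le> 1" for x
  proof -
    have "B * N x \<le> \<bar>B\<bar> * 1"
      using that norm_nonneg[of x] by (intro mult_mono) auto
    then show ?thesis using B[OF that(1)] by simp
  qed
  then show ?thesis by (auto intro!: bdd_aboveI)
qed

lemma norm_le_dual_norm:
  assumes "\<phi> \<in> dual_on s X N" "x \<in> X" "N x \<le> 1"
  shows "norm (\<phi> x) \<le> dual_norm_on X N \<phi>"
  unfolding dual_norm_on_def by (rule cSUP_upper[OF _ bdd_above_dual]) (use assms in auto)

lemma dual_norm_nonneg:
  assumes "\<phi> \<in> dual_on s X N" shows "0 \<le> dual_norm_on X N \<phi>"
  using norm_le_dual_norm[OF assms, of 0] norm_eq_0_iff[of 0] dual_onD(4)[OF assms] by simp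

lemma norm_le_dual_norm_mult:
  assumes "\<phi> \<in> dual_on s X N" "x \<in> X"
  shows "norm (\<phi> x) \<le> dual_norm_on X N \<phi> * N x"
proof (cases "x = 0")
  case True
  then show ?thesis using dual_onD(4)[OF assms(1)] norm_eq_0_iff[of 0] by simp
next
  case False
  then have pos: "N x > 0"
    using norm_eq_0_iff[of x] norm_nonneg[of x] assms by auto
  let ?y = "s (of_real (1 / N x)) x"
  have "N ?y = 1"
    using pos assms by (simp add: norm_scale norm_divide)
  then have "norm (\<phi> ?y) \<le> dual_norm_on X N \<phi>"
    using norm_le_dual_norm[OF assms(1), of ?y] assms by simp
  moreover have "norm (\<phi> ?y) = norm (\<phi> x) / N x"
    using pos dual_onD(3)[OF assms] by (simp add: norm_mult norm_divide)
  ultimately show ?thesis using pos by (simp add: pos_divide_le_eq)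
qed

lemma dual_normed_space_on: "normed_space_on fun_scale (dual_on s X N) (dual_norm_on X N)"
proof -
  interpret D: vector_space "fun_scale :: 'k \<Rightarrow> ('v \<Rightarrow> 'k) \<Rightarrow> _"
    by (rule vector_space_fun_scale)
  have add: "\<phi> + \<psi> \<in> dual_on s X N"
    if f: "\<phi> \<in> dual_on s X N" and g: "\<psi> \<in> dual_on s X N" for \<phi> \<psi>
  proof -
    have "norm (\<phi> x + \<psi> x) \<le> (dual_norm_on X N \<phi> + dual_norm_on X N \<psi>) * N x" if "x \<in> X" for x
      using norm_triangle_ineq[of "\<phi> x" "\<psi> x"] norm_le_dual_norm_mult[OF f that]
        norm_le_dual_norm_mult[OF g that] by (simp add: algebra_simps)
    then have "\<exists>B. \<forall>x\<in>X. norm (\<phi> x + \<psi> x) \<le> B * N x" by blast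
    then show ?thesis
      using dual_onD[OF f] dual_onD[OF g] unfolding dual_on_def by (auto simp: distrib_left)
  qed
  have scale: "fun_scale c \<phi> \<in> dual_on s X N" if f: "\<phi> \<in> dual_on s X N" for c \<phi>
  proof -
    have "norm (c * \<phi> x) \<le> (norm c * dual_norm_on X N \<phi>) * N x" if "x \<in> X" for x
      using mult_left_mono[OF norm_le_dual_norm_mult[OF f that] norm_ge_zero[of c]]
      by (simp add: norm_mult mult.assoc)
    then have "\<exists>B. \<forall>x\<in>X. norm (c * \<phi> x) \<le> B * N x" by blast
    then show ?thesis
      using dual_onD[OF f] unfolding dual_on_def fun_scale_def by (auto simp: algebra_simps)
  qed
  show ?thesis
  proof
    show "D.subspace (dual_on s X N)"
      using add scale by (auto simp: D.subspace_def dual_on_def intro!: exI[of _ 0])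
    fix \<phi> assume f: "\<phi> \<in> dual_on s X N"
    show "0 \<le> dual_norm_on X N \<phi>" by (rule dual_norm_nonneg[OF f])
    show "dual_norm_on X N \<phi> = 0 \<longleftrightarrow> \<phi> = 0"
    proof
      assume 0: "dual_norm_on X N \<phi> = 0"
      have "\<phi> x = 0" for x
        using norm_le_dual_norm_mult[OF f, of x] dual_onD(1)[OF f, of x] 0 by (cases "x \<in> X") auto
      then show "\<phi> = 0" by auto
    next
      assume "\<phi> = 0"
      then show "dual_norm_on X N \<phi> = 0"
        using dual_norm_on_least[of \<phi> 0] dual_norm_nonneg[OF f] by auto
    qed
    have le: "dual_norm_on X N (fun_scale c \<phi>) \<le> norm c * dual_norm_on X N \<phi>"
      if "\<phi> \<in> dual_on s X N" for c \<phi>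
      using norm_le_dual_norm[OF that]
      by (intro dual_norm_on_least) (auto simp: fun_scale_def norm_mult intro!: mult_left_mono)
    show "dual_norm_on X N (fun_scale c \<phi>) = norm c * dual_norm_on X N \<phi>" for c
    proof (cases "c = 0")
      case True
      then show ?thesis
        using le[OF f, of 0] dual_norm_nonneg[OF scale[OF f, of 0]] by simp
    next
      case False
      have "dual_norm_on X N (fun_scale (1/c) (fun_scale c \<phi>)) \<le>
            norm (1/c) * dual_norm_on X N (fun_scale c \<phi>)"
        by (rule le[OF scale[OF f]])
      also have "fun_scale (1/c) (fun_scale c \<phi>) = \<phi>"
        using False by simp
      finally show ?thesis
        using le[OF f, of c] False by (simp add: norm_divide field_simps)
    qed
    fix \<psi> assume g: "\<psi> \<in> dual_on s X N"
    show "dual_norm_on X N (\<phi> + \<psi>) \<le> dual_norm_on X N \<phi> + dual_norm_on X N \<psi>"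
    proof (rule dual_norm_on_least)
      fix x assume "x \<in> X" "N x \<le> 1"
      then show "norm ((\<phi> + \<psi>) x) \<le> dual_norm_on X N \<phi> + dual_norm_on X N \<psi>"
        using norm_triangle_ineq[of "\<phi> x" "\<psi> x"] norm_le_dual_norm[OF f] norm_le_dual_norm[OF g]
        by fastforce
    qed
  qed
qed

lemma closed_subspace_annihilator:
  "closed_subspace_on fun_scale (dual_on s X N) (dual_norm_on X N) (annihilator_on s X N U)"
proof -
  interpret D: normed_space_on fun_scale "dual_on s X N" "dual_norm_on X N"
    by (rule dual_normed_space_on)
  have "D.subspace (annihilator_on s X N U)"
    by (auto simp: D.subspace_def annihilator_on_def fun_scale_def)
       (use D.carrier_closed(4) in \<open>auto simp: fun_scale_def\<close>)
  moreover have "\<phi> x = 0"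
    if f: "\<phi> \<in> dual_on s X N" and x: "x \<in> U"
      and ap: "\<And>\<epsilon>. \<epsilon> > 0 \<Longrightarrow> \<exists>\<psi>\<in>annihilator_on s X N U. dual_norm_on X N (\<phi> - \<psi>) < \<epsilon>" for \<phi> x
  proof (cases "x \<in> X")
    case True
    have "norm (\<phi> x) \<le> 0 + \<epsilon>" if "\<epsilon> > 0" for \<epsilon>
    proof -
      have "\<epsilon> / (N x + 1) > 0" using that norm_nonneg[OF True] by (simp add: add_nonneg_pos)
      then obtain \<psi> where p: "\<psi> \<in> annihilator_on s X N U" "dual_norm_on X N (\<phi> - \<psi>) < \<epsilon> / (N x + 1)"
        using ap by blast
      then have "\<psi> \<in> dual_on s X N" "\<psi> x = 0" using x by (auto simp: annihilator_on_def)
      then have "norm (\<phi> x) \<le> dual_norm_on X N (\<phi> - \<psi>) * N x"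
        using norm_le_dual_norm_mult[OF D.carrier_closed(3)[OF f], of \<psi> x] True by simp
      also have "\<dots> \<le> \<epsilon> / (N x + 1) * (N x + 1)"
        using p that norm_nonneg[OF True] by (intro mult_mono) auto
      also have "\<dots> = \<epsilon>" using norm_nonneg[OF True] by simp
      finally show ?thesis by simp
    qed
    then have "norm (\<phi> x) \<le> 0" by (rule field_le_epsilon)
    then show ?thesis by simp
  qed (use dual_onD(1)[OF f] in auto)
  ultimately show ?thesis
    unfolding closed_subspace_on_def D.closedin_iff_approximable
    by (auto simp: annihilator_on_def)
qed

end

section \<open>M-ideals from smoothing operators\<close>

text \<open>
  The abstract situation behind the M-ideal property. The assumption \<open>T_tail\<close> says that the tails
  \<open>T m f - T n f\<close> are asymptotically disjoint from every fixed \<open>u\<close> in the sense of the maximum norm;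
  the bound 1/2 on \<open>f\<close> makes such a difference a vector of the unit ball. The assumption \<open>T_mix\<close> is
  the analogue, for averages over consecutive indices, of the inequality \<open>\<parallel>P f + (g - P g)\<parallel> \<le> max \<parallel>f\<parallel> \<parallel>g\<parallel>\<close>
  that an M-projection \<open>P\<close> satisfies.
\<close>

locale smoothing_operators = banach_space_on s X N
  for s :: "'k::{real_normed_field,banach} \<Rightarrow> 'v::ab_group_add \<Rightarrow> 'v" and X N +
  fixes U :: "'v set" and T :: "nat \<Rightarrow> 'v \<Rightarrow> 'v"
  assumes closed_subspace: "closed_subspace_on s X N U"
    and T_into: "f \<in> X \<Longrightarrow> T n f \<in> U"
    and T_add: "f \<in> X \<Longrightarrow> g \<in> X \<Longrightarrow> T n (f + g) = T n f + T n g"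
    and T_scale: "f \<in> X \<Longrightarrow> T n (s c f) = s c (T n f)"
    and T_contraction: "f \<in> X \<Longrightarrow> N (T n f) \<le> N f"
    and T_approx: "u \<in> U \<Longrightarrow> (\<lambda>n. N (u - T n u)) \<longlonglongrightarrow> 0"
    and T_tail: "\<lbrakk>u \<in> U; N u \<le> 1; f \<in> X; N f \<le> 1/2; \<epsilon> > 0\<rbrakk> \<Longrightarrow>
      \<exists>M. \<forall>m\<ge>M. \<forall>n\<ge>M. \<forall>c. norm c = 1 \<longrightarrow> N (u + s c (T m f - T n f)) \<le> 1 + \<epsilon>"
    and T_mix: "\<lbrakk>f \<in> X; g \<in> X; N f \<le> 1; N g \<le> 1; \<epsilon> > 0\<rbrakk> \<Longrightarrow>
      \<exists>K>0. N (\<Sum>n=M..<M+K. T n f + (g - T n g)) \<le> (1 + \<epsilon>) * real K"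
begin

lemma U_closed:
  "U \<subseteq> X" "0 \<in> U" "u \<in> U \<Longrightarrow> v \<in> U \<Longrightarrow> u + v \<in> U" "u \<in> U \<Longrightarrow> v \<in> U \<Longrightarrow> u - v \<in> U"
  "u \<in> U \<Longrightarrow> s c u \<in> U" "u \<in> U \<Longrightarrow> u \<in> X"
  using closed_subspace subspace_0 subspace_add subspace_diff subspace_scale
  by (auto simp: closed_subspace_on_def closedin_iff_approximable)

lemma T_carrier: "f \<in> X \<Longrightarrow> T n f \<in> X"
  using T_into U_closed by auto

text \<open>
  Let \<open>b\<close> be the norm of \<open>\<phi>\<close> on \<open>U\<close> and let \<open>u\<close> in the unit ball of \<open>U\<close> satisfy \<open>|\<phi> u| > b - \<epsilon>\<close>. After
  a rotation, \<open>|\<phi> u| + |\<phi> (T m f - T n f)|\<close> is the value of \<open>|\<phi>|\<close> at a vector of \<open>U\<close> of norm at most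
  \<open>1 + \<epsilon>\<close>, hence at most \<open>b (1 + \<epsilon>)\<close>. This forces the second summand to be small, so the sequence is
  Cauchy.
\<close>

lemma functional_T_convergent_small:
  assumes \<phi>: "\<phi> \<in> dual_on s X N" and f: "f \<in> X" "N f \<le> 1/2"
  shows "convergent (\<lambda>n. \<phi> (T n f))"
proof -
  define A where "A = (\<lambda>u. norm (\<phi> u)) ` {u \<in> U. N u \<le> 1}"
  define b where "b = Sup A"
  have "A \<subseteq> (\<lambda>x. norm (\<phi> x)) ` {x \<in> X. N x \<le> 1}" using U_closed(1) by (auto simp: A_def)
  then have bdd: "bdd_above A" using bdd_above_dual[OF \<phi>] by (rule bdd_above_mono[rotated])
  have N0: "N 0 = 0" using norm_eq_0_iff[of 0] by simp
  have ne: "0 \<in> A" using U_closed(2) N0 dual_onD(4)[OF \<phi>] by (auto simp: A_def image_iff)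
  have b0: "0 \<le> b" unfolding b_def by (rule cSup_upper[OF ne bdd])
  have le: "norm (\<phi> v) \<le> b * r" if v: "v \<in> U" "N v \<le> r" "r > 0" for v r
  proof -
    let ?w = "s (of_real (1 / r)) v"
    have "N ?w \<le> 1" using v U_closed by (simp add: norm_scale norm_divide)
    then have "norm (\<phi> ?w) \<le> b"
      unfolding b_def using v U_closed(5) by (intro cSup_upper[OF _ bdd]) (auto simp: A_def)
    moreover have "norm (\<phi> ?w) = norm (\<phi> v) / r"
      using v U_closed dual_onD(3)[OF \<phi>, of v] by (simp add: norm_mult norm_divide)
    ultimately show ?thesis using v by (simp add: pos_divide_le_eq)
  qed
  have "Cauchy (\<lambda>n. \<phi> (T n f))"
  proof (rule metric_CauchyI)
    fix e :: real assume e: "e > 0"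
    define \<epsilon> where "\<epsilon> = e / 2 / (b + 1)"
    have \<epsilon>: "\<epsilon> > 0" using e b0 by (simp add: \<epsilon>_def)
    have "b - \<epsilon> < Sup A" using \<epsilon> by (simp add: b_def)
    then obtain u where u: "u \<in> U" "N u \<le> 1" "norm (\<phi> u) > b - \<epsilon>"
      using ne bdd by (subst (asm) less_cSup_iff) (auto simp: A_def)
    obtain M where M: "\<And>m n c. m \<ge> M \<Longrightarrow> n \<ge> M \<Longrightarrow> norm c = 1 \<Longrightarrow>
        N (u + s c (T m f - T n f)) \<le> 1 + \<epsilon>"
      using T_tail[OF u(1,2) f \<epsilon>] by metis
    have "dist (\<phi> (T m f)) (\<phi> (T n f)) < e" if mn: "m \<ge> M" "n \<ge> M" for m n
    proof -
      have D: "T m f - T n f \<in> U" using U_closed T_into f by auto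
      obtain c d where c: "norm c = 1" "norm d = 1"
        "norm (c * \<phi> u + d * \<phi> (T m f - T n f)) = norm (\<phi> u) + norm (\<phi> (T m f - T n f))"
        using norm_add_rotated by blast
      have nz: "c \<noteq> 0" using c(1) by auto
      \<comment> \<open>dividing by \<open>c\<close> keeps \<open>u\<close> unrotated, as the tail estimate requires\<close>
      let ?v = "u + s (d / c) (T m f - T n f)"
      have vU: "?v \<in> U" using u D U_closed by auto
      have "c * \<phi> ?v = c * \<phi> u + d * \<phi> (T m f - T n f)"
        using u D U_closed nz by (simp add: dual_onD(2,3)[OF \<phi>] distrib_left del: scale_right_diff_distrib)
      then have "norm (\<phi> u) + norm (\<phi> (T m f - T n f)) = norm (\<phi> ?v)"
        using c by (metis norm_mult mult_1)
      also have "\<dots> \<le> b * (1 + \<epsilon>)"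
        using vU M[OF mn, of "d / c"] c \<epsilon> by (intro le) (auto simp: norm_divide)
      finally have "norm (\<phi> (T m f - T n f)) < \<epsilon> + b * \<epsilon>" using u(3) by (simp add: algebra_simps)
      also have "\<dots> = (b + 1) * \<epsilon>" by (simp add: algebra_simps)
      also have "\<dots> = e / 2"
        unfolding \<epsilon>_def using b0 by (intro nonzero_mult_div_cancel_left[THEN trans[OF times_divide_eq_right]]) simp
      finally show ?thesis
        using e T_carrier f by (simp add: dist_norm dual_onD[OF \<phi>])
    qed
    then show "\<exists>M. \<forall>m\<ge>M. \<forall>n\<ge>M. dist (\<phi> (T m f)) (\<phi> (T n f)) < e" by blast
  qed
  then show ?thesis by (rule Cauchy_convergent)
qed

text \<open>
  This is the canonical norm-preserving extension to \<open>X\<close> of the restriction of \<open>\<phi>\<close> to \<open>U\<close>.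
\<close>

definition limit_functional :: "('v \<Rightarrow> 'k) \<Rightarrow> 'v \<Rightarrow> 'k" where
  "limit_functional \<phi> f = (if f \<in> X then lim (\<lambda>n. \<phi> (T n f)) else 0)"

lemma functional_T_tendsto:
  assumes \<phi>: "\<phi> \<in> dual_on s X N" and f: "f \<in> X"
  shows "(\<lambda>n. \<phi> (T n f)) \<longlonglongrightarrow> limit_functional \<phi> f"
proof -
  \<comment> \<open>scale \<open>f\<close> to norm at most 1/2\<close>
  define r where "r = 1 / (2 * (N f + 1))"
  have r: "r > 0" using norm_nonneg[OF f] by (simp add: r_def)
  let ?g = "s (of_real r) f"
  have "N ?g = N f / (2 * (N f + 1))"
    using f r by (simp add: norm_scale del: of_real_divide) (simp add: r_def)
  also have "\<dots> \<le> 1/2" using norm_nonneg[OF f] by (simp add: field_simps)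
  finally have "convergent (\<lambda>n. \<phi> (T n ?g))"
    by (intro functional_T_convergent_small[OF \<phi>]) (use f in auto)
  moreover have "(\<lambda>n. \<phi> (T n ?g)) = (\<lambda>n. of_real r * \<phi> (T n f))"
    using f T_carrier by (simp add: T_scale dual_onD[OF \<phi>])
  ultimately have "convergent (\<lambda>n. \<phi> (T n f))"
    using r convergent_mult_const_iff[of "of_real r :: 'k" "\<lambda>n. \<phi> (T n f)"] by simp
  then show ?thesis using f by (simp add: limit_functional_def convergent_LIMSEQ_iff)
qed

lemma limit_functional_dual:
  assumes \<phi>: "\<phi> \<in> dual_on s X N"
  shows "limit_functional \<phi> \<in> dual_on s X N"
proof -
  note lim = functional_T_tendsto[OF \<phi>]
  have "limit_functional \<phi> (f + g) = limit_functional \<phi> f + limit_functional \<phi> g"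
    if "f \<in> X" "g \<in> X" for f g
    using LIMSEQ_unique[OF lim[of "f + g"]] tendsto_add[OF lim[OF that(1)] lim[OF that(2)]] that
    by (simp add: T_add T_carrier dual_onD[OF \<phi>])
  moreover have "limit_functional \<phi> (s c f) = c * limit_functional \<phi> f" if "f \<in> X" for f c
    using LIMSEQ_unique[OF lim[of "s c f"]] tendsto_mult[OF tendsto_const[of c] lim[OF that]] that
    by (simp add: T_scale T_carrier dual_onD[OF \<phi>])
  moreover
  have "norm (limit_functional \<phi> f) \<le> dual_norm_on X N \<phi> * N f" if f: "f \<in> X" for f
  proof (rule LIMSEQ_le_const2[OF tendsto_norm[OF lim[OF f]]])
    have "norm (\<phi> (T n f)) \<le> dual_norm_on X N \<phi> * N f" for n
      by (rule order_trans[OF norm_le_dual_norm_mult[OF \<phi> T_carrier[OF f]]])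
        (intro mult_left_mono dual_norm_nonneg[OF \<phi>] T_contraction[OF f])
    then show "\<exists>M. \<forall>n\<ge>M. norm (\<phi> (T n f)) \<le> dual_norm_on X N \<phi> * N f" by blast
  qed
  then have "\<exists>B. \<forall>f\<in>X. norm (limit_functional \<phi> f) \<le> B * N f" by blast
  ultimately show ?thesis
    unfolding dual_on_def by (auto simp: limit_functional_def)
qed

lemma limit_functional_eq_on_U:
  assumes \<phi>: "\<phi> \<in> dual_on s X N" and u: "u \<in> U"
  shows "limit_functional \<phi> u = \<phi> u"
proof (rule LIMSEQ_unique[OF functional_T_tendsto[OF \<phi>]])
  show "u \<in> X" using u U_closed by auto
  have "(\<lambda>n. \<phi> u - \<phi> (T n u)) \<longlonglongrightarrow> 0"
  proof (rule Lim_null_comparison)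
    show "\<forall>\<^sub>F n in sequentially. norm (\<phi> u - \<phi> (T n u)) \<le> dual_norm_on X N \<phi> * N (u - T n u)"
      using norm_le_dual_norm_mult[OF \<phi>, of "u - T _ u"] \<open>u \<in> X\<close> T_carrier
      by (simp add: dual_onD[OF \<phi>])
    show "(\<lambda>n. dual_norm_on X N \<phi> * N (u - T n u)) \<longlonglongrightarrow> 0"
      using tendsto_mult[OF tendsto_const T_approx[OF u]] by simp
  qed
  from tendsto_diff[OF tendsto_const[of "\<phi> u"] this] show "(\<lambda>n. \<phi> (T n u)) \<longlonglongrightarrow> \<phi> u" by simp
qed

text \<open>
  The left-hand side is the limit of \<open>\<phi>\<close> along \<open>T n f + (g - T n g)\<close>. These vectors may have
  norm well above 1, but suitable averages of finitely many late ones have norm at most slightly above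
  1, and the value of \<open>\<phi>\<close> at such an
  average is still close to the limit.
\<close>

lemma mixed_functional_bound:
  assumes \<phi>: "\<phi> \<in> dual_on s X N" and fg: "f \<in> X" "g \<in> X" "N f \<le> 1" "N g \<le> 1"
  shows "norm (limit_functional \<phi> f + (\<phi> g - limit_functional \<phi> g)) \<le> dual_norm_on X N \<phi>"
proof (rule field_le_epsilon)
  fix e :: real assume e: "e > 0"
  define b where "b = dual_norm_on X N \<phi>"
  have b0: "b \<ge> 0" using dual_norm_nonneg[OF \<phi>] by (simp add: b_def)
  define \<epsilon> where "\<epsilon> = e / (b + 1)"
  have \<epsilon>: "\<epsilon> > 0" using e b0 by (simp add: \<epsilon>_def)
  define l where "l = limit_functional \<phi> f + (\<phi> g - limit_functional \<phi> g)"
  define y where "y n = T n f + (g - T n g)" for n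
  have yX: "y n \<in> X" for n using fg T_carrier by (simp add: y_def)
  have "(\<lambda>n. \<phi> (y n)) \<longlonglongrightarrow> l"
    unfolding y_def l_def using fg T_carrier
    by (auto simp: dual_onD[OF \<phi>] intro!: tendsto_intros functional_T_tendsto[OF \<phi>])
  then obtain M where M: "\<And>n. n \<ge> M \<Longrightarrow> norm (\<phi> (y n) - l) < \<epsilon>"
    using \<epsilon> by (meson LIMSEQ_D)
  obtain K where K: "K > 0" "N (\<Sum>n=M..<M+K. y n) \<le> (1 + \<epsilon>) * real K"
    using T_mix[OF fg \<epsilon>] unfolding y_def by blast
  have "real K * norm l = norm (\<Sum>n=M..<M+K. l)" by (simp add: norm_mult)
  also have "\<dots> = norm (\<phi> (\<Sum>n=M..<M+K. y n) - (\<Sum>n=M..<M+K. \<phi> (y n) - l))"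
    using dual_on_sum[OF \<phi>, of "{M..<M+K}" y] yX by (simp add: sum_subtractf)
  also have "\<dots> \<le> norm (\<phi> (\<Sum>n=M..<M+K. y n)) + norm (\<Sum>n=M..<M+K. \<phi> (y n) - l)"
    by (rule norm_triangle_ineq4)
  also have "norm (\<phi> (\<Sum>n=M..<M+K. y n)) \<le> b * N (\<Sum>n=M..<M+K. y n)"
    unfolding b_def using dual_on_sum[OF \<phi>, of "{M..<M+K}" y] yX
    by (intro norm_le_dual_norm_mult[OF \<phi>]) auto
  also have "\<dots> \<le> b * ((1 + \<epsilon>) * real K)" using K b0 by (intro mult_left_mono)
  also have "norm (\<Sum>n=M..<M+K. \<phi> (y n) - l) \<le> (\<Sum>n=M..<M+K. \<epsilon>)"
    using M by (intro sum_norm_le) (auto intro: less_imp_le)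
  finally have "real K * norm l \<le> real K * (b * (1 + \<epsilon>) + \<epsilon>)" by (simp add: algebra_simps)
  then have "norm l \<le> b * (1 + \<epsilon>) + \<epsilon>"
    by (rule mult_left_le_imp_le) (use K in simp)
  also have "\<dots> = b + \<epsilon> * (b + 1)" by (simp add: algebra_simps)
  also have "\<epsilon> * (b + 1) = e" using b0 by (simp add: \<epsilon>_def)
  finally show "norm (limit_functional \<phi> f + (\<phi> g - limit_functional \<phi> g)) \<le> dual_norm_on X N \<phi> + e"
    by (simp add: l_def b_def)
qed

text \<open>
  For the nontrivial inequality, test \<open>limit_functional \<phi>\<close> and \<open>\<phi> - limit_functional \<phi>\<close> on separate vectors of the
  unit ball, rotated so that the two values add up in absolute value.
\<close>

lemma dual_norm_split:
  assumes \<phi>: "\<phi> \<in> dual_on s X N"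
  shows "dual_norm_on X N \<phi> =
    dual_norm_on X N (\<phi> - limit_functional \<phi>) + dual_norm_on X N (limit_functional \<phi>)"
proof -
  interpret D: normed_space_on fun_scale "dual_on s X N" "dual_norm_on X N"
    by (rule dual_normed_space_on)
  note L = limit_functional_dual[OF \<phi>]
  have R: "\<phi> - limit_functional \<phi> \<in> dual_on s X N" using \<phi> L by simp
  have "norm (limit_functional \<phi> f) + norm ((\<phi> - limit_functional \<phi>) g) \<le> dual_norm_on X N \<phi>"
    if fg: "f \<in> X" "N f \<le> 1" "g \<in> X" "N g \<le> 1" for f g
  proof -
    obtain c d where c: "norm c = 1" "norm d = 1"
      "norm (c * limit_functional \<phi> f + d * (\<phi> - limit_functional \<phi>) g) =
       norm (limit_functional \<phi> f) + norm ((\<phi> - limit_functional \<phi>) g)"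
      using norm_add_rotated by blast
    have "limit_functional \<phi> (s c f) + (\<phi> (s d g) - limit_functional \<phi> (s d g)) =
        c * limit_functional \<phi> f + d * (\<phi> - limit_functional \<phi>) g"
      using fg by (simp add: dual_onD[OF \<phi>] dual_onD[OF L] algebra_simps)
    moreover have "N (s c f) \<le> 1" "N (s d g) \<le> 1" using fg c by (simp_all add: norm_scale)
    ultimately show ?thesis
      using mixed_functional_bound[OF \<phi>, of "s c f" "s d g"] fg c by simp
  qed
  then have "norm ((\<phi> - limit_functional \<phi>) g) \<le> dual_norm_on X N \<phi> - norm (limit_functional \<phi> f)"
    if "f \<in> X" "N f \<le> 1" "g \<in> X" "N g \<le> 1" for f g
    using that by (smt (verit))
  then have "dual_norm_on X N (\<phi> - limit_functional \<phi>) \<le>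
      dual_norm_on X N \<phi> - norm (limit_functional \<phi> f)" if "f \<in> X" "N f \<le> 1" for f
    using that by (intro dual_norm_on_least) blast
  then have "dual_norm_on X N (limit_functional \<phi>) \<le>
      dual_norm_on X N \<phi> - dual_norm_on X N (\<phi> - limit_functional \<phi>)"
    by (intro dual_norm_on_least) (smt (verit))
  moreover have "dual_norm_on X N \<phi> \<le>
      dual_norm_on X N (\<phi> - limit_functional \<phi>) + dual_norm_on X N (limit_functional \<phi>)"
    using D.norm_triangle[OF R L] by simp
  ultimately show ?thesis by simp
qed

text \<open>
  The map \<open>\<phi> \<mapsto> \<phi> - limit_functional \<phi>\<close> is the required L-projection; it fixes the annihilator of \<open>U\<close>
  because all \<open>T n f\<close> lie in \<open>U\<close>.
\<close>

lemma M_ideal_U: "M_ideal s X N U"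
proof -
  interpret D: normed_space_on fun_scale "dual_on s X N" "dual_norm_on X N"
    by (rule dual_normed_space_on)
  define P where "P \<phi> = \<phi> - limit_functional \<phi>" for \<phi>
  have P_into: "P \<phi> \<in> annihilator_on s X N U" if "\<phi> \<in> dual_on s X N" for \<phi>
    using that limit_functional_dual[OF that] limit_functional_eq_on_U[OF that]
    by (auto simp: P_def annihilator_on_def)
  have lim_0: "limit_functional \<phi> = 0" if "\<phi> \<in> annihilator_on s X N U" for \<phi>
  proof
    fix f
    show "limit_functional \<phi> f = 0 f"
      using that T_into by (auto simp: limit_functional_def annihilator_on_def)
  qed
  have add: "limit_functional (\<phi> + \<psi>) = limit_functional \<phi> + limit_functional \<psi>"
    if "\<phi> \<in> dual_on s X N" "\<psi> \<in> dual_on s X N" for \<phi> \<psi>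
  proof
    fix f
    show "limit_functional (\<phi> + \<psi>) f = (limit_functional \<phi> + limit_functional \<psi>) f"
    proof (cases "f \<in> X")
      case True
      then show ?thesis
        using LIMSEQ_unique[OF functional_T_tendsto[OF D.carrier_closed(2)[OF that] True]]
          tendsto_add[OF functional_T_tendsto[OF that(1) True] functional_T_tendsto[OF that(2) True]]
        by simp
    qed (simp add: limit_functional_def)
  qed
  have scale: "limit_functional (fun_scale c \<phi>) = fun_scale c (limit_functional \<phi>)"
    if "\<phi> \<in> dual_on s X N" for \<phi> c
  proof
    fix f
    show "limit_functional (fun_scale c \<phi>) f = fun_scale c (limit_functional \<phi>) f"
    proof (cases "f \<in> X")
      case True
      then show ?thesis
        using LIMSEQ_unique[OF functional_T_tendsto[OF D.carrier_closed(4)[OF that, of c] True]]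
          tendsto_mult[OF tendsto_const[of c] functional_T_tendsto[OF that(1) True]]
        by (simp add: fun_scale_def)
    qed (simp add: limit_functional_def fun_scale_def)
  qed
  have "linear_projection_on fun_scale (dual_on s X N) P"
    unfolding linear_projection_on_def
  proof (intro conjI ballI allI)
    fix \<phi> assume f: "\<phi> \<in> dual_on s X N"
    show "P \<phi> \<in> dual_on s X N" using P_into[OF f] by (simp add: annihilator_on_def)
    show "P (P \<phi>) = P \<phi>" using lim_0[OF P_into[OF f]] by (simp add: P_def)
    show "P (fun_scale c \<phi>) = fun_scale c (P \<phi>)" for c
      using scale[OF f] by (simp add: P_def D.scale_right_diff_distrib)
    show "P (\<phi> + \<psi>) = P \<phi> + P \<psi>" if "\<psi> \<in> dual_on s X N" for \<psi>
      using add[OF f that] by (simp add: P_def)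
  qed
  then have "L_projection fun_scale (dual_on s X N) (dual_norm_on X N) P"
    unfolding L_projection_def using dual_norm_split by (simp add: P_def)
  moreover have "P ` dual_on s X N = annihilator_on s X N U"
  proof
    show "annihilator_on s X N U \<subseteq> P ` dual_on s X N"
    proof
      fix \<phi> assume a: "\<phi> \<in> annihilator_on s X N U"
      then have "P \<phi> = \<phi>" "\<phi> \<in> dual_on s X N"
        using lim_0[OF a] by (auto simp: P_def annihilator_on_def)
      then show "\<phi> \<in> P ` dual_on s X N" by (metis imageI)
    qed
  qed (use P_into in auto)
  ultimately have "L_summand fun_scale (dual_on s X N) (dual_norm_on X N) (annihilator_on s X N U)"
    unfolding L_summand_def using closed_subspace_annihilator by blast
  then show ?thesis
    unfolding M_ideal_def using banach_space_on_axioms closed_subspace by blast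
qed

end

section \<open>Elementary inequalities\<close>

lemma small_powr:
  fixes c \<beta> \<epsilon> :: real
  assumes "0 \<le> c" "0 < \<beta>" "0 < \<epsilon>"
  shows "\<exists>\<delta>>0. \<forall>d. 0 \<le> d \<longrightarrow> d < \<delta> \<longrightarrow> c * d powr \<beta> < \<epsilon>"
proof (intro exI[of _ "(\<epsilon> / (c + 1)) powr (1 / \<beta>)"] conjI allI impI)
  fix d :: real assume d: "0 \<le> d" "d < (\<epsilon> / (c + 1)) powr (1 / \<beta>)"
  have "d powr \<beta> < ((\<epsilon> / (c + 1)) powr (1 / \<beta>)) powr \<beta>"
    using d assms by (intro powr_less_mono2) auto
  also have "\<dots> = \<epsilon> / (c + 1)"
    using assms by (simp add: powr_powr)
  finally have "d powr \<beta> * (c + 1) < \<epsilon>"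
    using assms by (simp add: pos_less_divide_eq)
  moreover have "c * d powr \<beta> \<le> d powr \<beta> * (c + 1)" by (simp add: algebra_simps)
  ultimately show "c * d powr \<beta> < \<epsilon>" by linarith
qed (use assms in simp)

text \<open>
  Subadditivity of \<open>t \<mapsto> t powr \<alpha>\<close>: write \<open>a powr \<alpha> = a * a powr (\<alpha> - 1)\<close>, split the first factor as
  \<open>b + (a - b)\<close>, and use that \<open>t powr (\<alpha> - 1)\<close> decreases in \<open>t\<close>.
\<close>

lemma powr_diff_le:
  fixes x y \<alpha> :: real
  assumes "0 \<le> x" "0 \<le> y" "0 < \<alpha>" "\<alpha> \<le> 1"
  shows "\<bar>x powr \<alpha> - y powr \<alpha>\<bar> \<le> \<bar>x - y\<bar> powr \<alpha>"
proof -
  have *: "a powr \<alpha> \<le> b powr \<alpha> + (a - b) powr \<alpha>" if "0 \<le> b" "b \<le> a" for a b :: real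
  proof (cases "b = 0 \<or> b = a")
    case False
    then have b: "0 < b" "b < a" using that by auto
    have eq: "t powr \<alpha> = t * t powr (\<alpha> - 1)" if "t > 0" for t :: real
      using that by (simp add: powr_diff)
    have "a powr \<alpha> = b * a powr (\<alpha> - 1) + (a - b) * a powr (\<alpha> - 1)"
      using eq[of a] b by (simp add: algebra_simps)
    also have "\<dots> \<le> b * b powr (\<alpha> - 1) + (a - b) * (a - b) powr (\<alpha> - 1)"
      using b assms by (intro add_mono mult_left_mono powr_mono2') auto
    finally show ?thesis using eq[of b] eq[of "a - b"] b by simp
  qed (use assms in auto)
  show ?thesis
  proof (cases "y \<le> x")
    case True
    then show ?thesis using *[of y x] powr_mono2[of \<alpha> y x] assms by simp
  next
    case False
    then show ?thesis using *[of x y] powr_mono2[of \<alpha> x y] assms by simp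
  qed
qed

lemma sum_geometric_inj_le:
  fixes p :: real
  assumes "finite A" "inj_on j A" "0 \<le> p" "p < 1"
  shows "(\<Sum>n\<in>A. p ^ j n) \<le> 1 / (1 - p)"
proof -
  have "(\<Sum>n\<in>A. p ^ j n) = (\<Sum>i\<in>j ` A. p ^ i)"
    using assms by (simp add: sum.reindex)
  also have "\<dots> \<le> (\<Sum>i. p ^ i)"
    using assms by (intro sum_le_suminf summable_geometric) auto
  also have "\<dots> = 1 / (1 - p)"
    using assms by (intro suminf_geometric) auto
  finally show ?thesis .
qed

lemma dyadic_scale:
  fixes d :: real
  assumes "0 < d" "d \<le> 1"
  shows "\<exists>m. (1/2) ^ Suc m < d \<and> d \<le> (1/2) ^ m"
proof -
  have "\<exists>k. (1/2) ^ k < d" using real_arch_pow_inv[of d "1/2"] assms by simp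
  then obtain k where k: "(1/2) ^ k < d" "\<And>i. i < k \<Longrightarrow> \<not> (1/2) ^ i < d"
    using exists_least_iff[of "\<lambda>k. (1/2) ^ k < d"] by blast
  show ?thesis
  proof (cases k)
    case 0
    then show ?thesis using k assms by simp
  next
    case (Suc m)
    have "d \<le> (1/2) ^ m" using k(2)[of m] Suc by (simp add: not_less)
    moreover have "(1/2) ^ Suc m < d" using k(1) unfolding Suc .
    ultimately show ?thesis by (intro exI[of _ m] conjI)
  qed
qed

section \<open>Spaces of Hoelder functions\<close>

locale holder_exponent =
  fixes \<alpha> :: real
  assumes \<alpha>: "0 < \<alpha>" "\<alpha> < 1"
begin

abbreviation Lip :: "(real \<Rightarrow> 'k::real_normed_field) \<Rightarrow> real"
  where "Lip \<equiv> holder_norm \<alpha>"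

lemma holder_quot_le_iff: "x \<noteq> y \<Longrightarrow> holder_quot \<alpha> f x y \<le> c \<longleftrightarrow> norm (f x - f y) \<le> c * \<bar>x - y\<bar> powr \<alpha>"
  by (simp add: holder_quot_def pos_divide_le_eq)

lemma holder_quot_less_iff: "x \<noteq> y \<Longrightarrow> holder_quot \<alpha> f x y < c \<longleftrightarrow> norm (f x - f y) < c * \<bar>x - y\<bar> powr \<alpha>"
  by (simp add: holder_quot_def pos_divide_less_eq)

lemma holder_quot_add: "holder_quot \<alpha> (f + g) x y \<le> holder_quot \<alpha> f x y + holder_quot \<alpha> g x y"
proof -
  have "norm ((f + g) x - (f + g) y) \<le> norm (f x - f y) + norm (g x - g y)"
    using norm_triangle_ineq[of "f x - f y" "g x - g y"] by (simp add: algebra_simps)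
  then show ?thesis by (simp add: holder_quot_def divide_right_mono flip: add_divide_distrib)
qed

lemma holder_quot_scale: "holder_quot \<alpha> (fun_scale c f) x y = norm c * holder_quot \<alpha> f x y"
  by (simp add: holder_quot_def fun_scale_def flip: norm_mult right_diff_distrib)

lemma holder_quots_nonempty: "holder_quots \<alpha> f \<noteq> {}"
proof -
  have "holder_quot \<alpha> f 0 1 \<in> holder_quots \<alpha> f"
    unfolding holder_quots_def by (intro CollectI exI[of _ 0] exI[of _ 1]) simp
  then show ?thesis by blast
qed

lemma holder_quot_le_norm:
  assumes "f \<in> holder_space \<alpha>" "x \<in> {0..1}" "y \<in> {0..1}" "x \<noteq> y"
  shows "holder_quot \<alpha> f x y \<le> Lip f"
  unfolding holder_norm_def
  by (rule cSup_upper) (use assms in \<open>auto simp: holder_space_def holder_quots_def\<close>)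

lemma holder_bound:
  assumes "f \<in> holder_space \<alpha>" "x \<in> {0..1}" "y \<in> {0..1}"
  shows "norm (f x - f y) \<le> Lip f * \<bar>x - y\<bar> powr \<alpha>"
proof (cases "x = y")
  case False
  then show ?thesis using holder_quot_le_norm[OF assms False] by (simp add: holder_quot_le_iff)
qed simp

lemma holder_spaceD:
  assumes "f \<in> holder_space \<alpha>"
  shows "x \<notin> {0..1} \<Longrightarrow> f x = 0" "f 0 = 0"
  using assms by (auto simp: holder_space_def)

lemma holder_norm_nonneg: "f \<in> holder_space \<alpha> \<Longrightarrow> 0 \<le> Lip f"
  using order_trans[OF norm_ge_zero holder_bound[of f 0 1]] by simp

lemma norm_le_holder_norm:
  assumes "f \<in> holder_space \<alpha>"
  shows "norm (f x) \<le> Lip f"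
proof (cases "x \<in> {0..1}")
  case True
  have "norm (f x) \<le> Lip f * \<bar>x\<bar> powr \<alpha>"
    using holder_bound[OF assms True, of 0] holder_spaceD[OF assms] by simp
  also have "\<dots> \<le> Lip f * 1"
    using True \<alpha> holder_norm_nonneg[OF assms] by (intro mult_left_mono) (auto simp: powr_le1)
  finally show ?thesis by simp
qed (use holder_spaceD[OF assms] holder_norm_nonneg[OF assms] in auto)

lemma holder_spaceI:
  assumes "\<And>x. x \<notin> {0..1} \<Longrightarrow> f x = 0" "f 0 = 0"
    and "\<And>x y. x \<in> {0..1} \<Longrightarrow> y \<in> {0..1} \<Longrightarrow> x \<noteq> y \<Longrightarrow> norm (f x - f y) \<le> B * \<bar>x - y\<bar> powr \<alpha>"
  shows "f \<in> holder_space \<alpha>" "Lip f \<le> B"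
proof -
  have B: "q \<le> B" if "q \<in> holder_quots \<alpha> f" for q
    using that assms(3) by (auto simp: holder_quots_def holder_quot_le_iff)
  then have "bdd_above (holder_quots \<alpha> f)" by (intro bdd_aboveI) 
  then show "f \<in> holder_space \<alpha>" using assms by (auto simp: holder_space_def)
  show "Lip f \<le> B" unfolding holder_norm_def using B holder_quots_nonempty by (intro cSup_least)
qed

lemma holder_add:
  assumes "f \<in> holder_space \<alpha>" "g \<in> holder_space \<alpha>"
  shows "f + g \<in> holder_space \<alpha>" "Lip (f + g) \<le> Lip f + Lip g"
proof -
  have "norm ((f + g) x - (f + g) y) \<le> (Lip f + Lip g) * \<bar>x - y\<bar> powr \<alpha>"
    if "x \<in> {0..1}" "y \<in> {0..1}" for x y
    using norm_triangle_ineq[of "f x - f y" "g x - g y"]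
      holder_bound[OF assms(1) that] holder_bound[OF assms(2) that] by (simp add: algebra_simps)
  then show "f + g \<in> holder_space \<alpha>" "Lip (f + g) \<le> Lip f + Lip g"
    using holder_spaceI[of "f + g" "Lip f + Lip g"] assms by (auto simp: holder_spaceD)
qed

lemma holder_scale:
  assumes "f \<in> holder_space \<alpha>"
  shows "fun_scale c f \<in> holder_space \<alpha>" "Lip (fun_scale c f) \<le> norm c * Lip f"
proof -
  have "norm (fun_scale c f x - fun_scale c f y) \<le> (norm c * Lip f) * \<bar>x - y\<bar> powr \<alpha>"
    if "x \<in> {0..1}" "y \<in> {0..1}" for x y
    using mult_left_mono[OF holder_bound[OF assms that] norm_ge_zero[of c]]
    by (simp add: fun_scale_def mult.assoc flip: norm_mult right_diff_distrib)
  then show "fun_scale c f \<in> holder_space \<alpha>" "Lip (fun_scale c f) \<le> norm c * Lip f"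
    using holder_spaceI[of "fun_scale c f" "norm c * Lip f"] assms
    by (auto simp: holder_spaceD fun_scale_def)
qed

lemma holder_zero: "0 \<in> holder_space \<alpha>" "Lip (0 :: real \<Rightarrow> 'k::real_normed_field) = 0"
proof -
  have z: "(0 :: real \<Rightarrow> 'k) \<in> holder_space \<alpha>" by (rule holder_spaceI[of _ 0]) auto
  have "Lip (0 :: real \<Rightarrow> 'k) \<le> 0" by (rule holder_spaceI) auto
  then show "Lip (0 :: real \<Rightarrow> 'k) = 0" using holder_norm_nonneg[OF z] by simp
  show "0 \<in> holder_space \<alpha>" by (rule holder_spaceI[of _ 0]) auto
qed

lemma holder_normed_space:
  "normed_space_on fun_scale (holder_space \<alpha> :: (real \<Rightarrow> 'k::real_normed_field) set) Lip"
proof -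
  interpret V: vector_space "fun_scale :: 'k \<Rightarrow> (real \<Rightarrow> 'k) \<Rightarrow> _"
    by (rule vector_space_fun_scale)
  show ?thesis
  proof
    show "V.subspace (holder_space \<alpha>)"
      using holder_zero holder_add holder_scale by (auto simp: V.subspace_def)
    fix f g :: "real \<Rightarrow> 'k" and c
    assume f: "f \<in> holder_space \<alpha>"
    show "0 \<le> Lip f" by (rule holder_norm_nonneg[OF f])
    show "Lip f = 0 \<longleftrightarrow> f = 0"
      using norm_le_holder_norm[OF f] holder_zero(2) by (auto intro!: ext)
    show "Lip (fun_scale c f) = norm c * Lip f"
    proof (cases "c = 0")
      case True
      then show ?thesis using holder_zero by simp
    next
      case False
      have "Lip (fun_scale (1/c) (fun_scale c f)) \<le> norm (1/c) * Lip (fun_scale c f)"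
        by (intro holder_scale f)
      moreover have "fun_scale (1/c) (fun_scale c f) = f"
        using False by simp
      ultimately show ?thesis
        using holder_scale(2)[OF f, of c] False by (simp add: norm_divide field_simps)
    qed
    assume g: "g \<in> holder_space \<alpha>"
    show "Lip (f + g) \<le> Lip f + Lip g" by (rule holder_add[OF f g])
  qed
qed

sublocale H: normed_space_on "fun_scale :: 'k::real_normed_field \<Rightarrow> _" "holder_space \<alpha>" Lip
  by (rule holder_normed_space)

lemma holder_quot_perturb:
  assumes "f \<in> holder_space \<alpha>" "g \<in> holder_space \<alpha>" "x \<in> {0..1}" "y \<in> {0..1}" "x \<noteq> y"
  shows "holder_quot \<alpha> f x y \<le> holder_quot \<alpha> g x y + Lip (f - g)"
  using holder_quot_add[of g "f - g" x y] holder_quot_le_norm[of "f - g" x y] assms by simp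

text \<open>
  The limit is taken pointwise, since the Hoelder norm dominates the supremum norm; norm convergence
  follows by letting \<open>m\<close> tend to infinity in the increments of \<open>f n - f m\<close>.
\<close>

lemma holder_complete:
  fixes f :: "nat \<Rightarrow> real \<Rightarrow> 'k::{real_normed_field,banach}"
  assumes f: "\<And>n. f n \<in> holder_space \<alpha>"
    and cau: "\<And>\<epsilon>. \<epsilon> > 0 \<Longrightarrow> \<exists>M. \<forall>m\<ge>M. \<forall>n\<ge>M. Lip (f m - f n) < \<epsilon>"
  shows "\<exists>g\<in>holder_space \<alpha>. \<forall>\<epsilon>>0. \<exists>M. \<forall>n\<ge>M. Lip (f n - g) < \<epsilon>"
proof -
  have fd: "f m - f n \<in> holder_space \<alpha>" for m n using f by simp
  have "Cauchy (\<lambda>n. f n x)" for x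
  proof (rule metric_CauchyI)
    fix e :: real assume "e > 0"
    then obtain M where M: "\<forall>m\<ge>M. \<forall>n\<ge>M. Lip (f m - f n) < e" using cau by blast
    have "dist (f m x) (f n x) < e" if "m \<ge> M" "n \<ge> M" for m n
      using M that norm_le_holder_norm[OF fd, of m n x] by (fastforce simp: dist_norm)
    then show "\<exists>M. \<forall>m\<ge>M. \<forall>n\<ge>M. dist (f m x) (f n x) < e" by blast
  qed
  then have "\<exists>l. (\<lambda>n. f n x) \<longlonglongrightarrow> l" for x
    using Cauchy_convergent by (auto simp: convergent_def)
  then obtain g where g: "\<And>x. (\<lambda>n. f n x) \<longlonglongrightarrow> g x" by metis
  have g0: "g x = 0" if "\<And>n. f n x = 0" for x
    using LIMSEQ_unique[OF g[of x]] that by simp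
  have key: "\<exists>M. \<forall>n\<ge>M. f n - g \<in> holder_space \<alpha> \<and> Lip (f n - g) < \<epsilon>" if "\<epsilon> > 0" for \<epsilon>
  proof -
    obtain M where M: "\<forall>m\<ge>M. \<forall>n\<ge>M. Lip (f m - f n) < \<epsilon> / 2"
      using cau[of "\<epsilon> / 2"] \<open>\<epsilon> > 0\<close> by auto
    have "f n - g \<in> holder_space \<alpha> \<and> Lip (f n - g) \<le> \<epsilon> / 2" if n: "n \<ge> M" for n
    proof -
      have "norm ((f n - g) x - (f n - g) y) \<le> \<epsilon> / 2 * \<bar>x - y\<bar> powr \<alpha>"
        if xy: "x \<in> {0..1}" "y \<in> {0..1}" for x y
      proof (rule LIMSEQ_le_const2)
        show "(\<lambda>m. norm ((f n x - f m x) - (f n y - f m y))) \<longlonglongrightarrow> norm ((f n - g) x - (f n - g) y)"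
          unfolding fun_diff_def by (intro tendsto_intros g)
        have "norm ((f n x - f m x) - (f n y - f m y)) \<le> \<epsilon> / 2 * \<bar>x - y\<bar> powr \<alpha>" if "m \<ge> M" for m
        proof -
          have "norm ((f n x - f m x) - (f n y - f m y)) \<le> Lip (f n - f m) * \<bar>x - y\<bar> powr \<alpha>"
            using holder_bound[OF fd xy, of n m] by simp
          also have "\<dots> \<le> \<epsilon> / 2 * \<bar>x - y\<bar> powr \<alpha>"
            using M n that by (intro mult_right_mono) (auto intro: less_imp_le)
          finally show ?thesis .
        qed
        then show "\<exists>K. \<forall>m\<ge>K. norm ((f n x - f m x) - (f n y - f m y)) \<le> \<epsilon> / 2 * \<bar>x - y\<bar> powr \<alpha>"
          by blast
      qed
      then show ?thesis
        using holder_spaceI[of "f n - g" "\<epsilon> / 2"] holder_spaceD[OF f] g0 by auto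
    qed
    then show ?thesis using \<open>\<epsilon> > 0\<close> by (intro exI[of _ M]) (auto intro: le_less_trans[of _ "\<epsilon> / 2"])
  qed
  obtain M where "f M - g \<in> holder_space \<alpha>" using key[of 1] by auto
  then have "f M - (f M - g) \<in> holder_space \<alpha>" by (rule H.carrier_closed(3)[OF f])
  then have "g \<in> holder_space \<alpha>" by simp
  then show ?thesis using key by blast
qed

lemma little_subset_holder: "little_holder_space \<alpha> \<subseteq> holder_space \<alpha>"
  and omega_subset_holder: "omega_holder_space \<alpha> \<subseteq> holder_space \<alpha>"
  by (auto simp: little_holder_space_def omega_holder_space_def)

lemma little_holderE:
  assumes "f \<in> little_holder_space \<alpha>" "\<epsilon> > 0"
  obtains \<delta> where "\<delta> > 0"
    "\<And>x y. \<lbrakk>x \<in> {0..1}; y \<in> {0..1}; x \<noteq> y; \<bar>x - y\<bar> < \<delta>\<rbrakk> \<Longrightarrow> holder_quot \<alpha> f x y < \<epsilon>"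
proof -
  have "\<forall>\<epsilon>>0. \<exists>\<delta>>0. \<forall>x\<in>{0..1}. \<forall>y\<in>{0..1}. x \<noteq> y \<and> \<bar>x - y\<bar> < \<delta> \<longrightarrow> holder_quot \<alpha> f x y < \<epsilon>"
    using assms(1) by (simp add: little_holder_space_def)
  from spec[OF this, of \<epsilon>] show ?thesis
    using assms(2) that by metis
qed

text \<open>
  The local condition in the definition of \<open>omega_holder_space\<close>, isolated so that its stability under
  perturbations and sums can be stated separately from the choice of exceptional points.
\<close>

definition oscillation_le_off :: "real set \<Rightarrow> (real \<Rightarrow> 'k::real_normed_field) \<Rightarrow> real \<Rightarrow> bool" where
  "oscillation_le_off F f \<epsilon> \<longleftrightarrow> (\<forall>t\<in>{0..1} - F. \<exists>U. openin (top_of_set {0..1}) U \<and> t \<in> U \<and>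
     (\<forall>x\<in>U. \<forall>y\<in>U. x \<noteq> y \<longrightarrow> holder_quot \<alpha> f x y \<le> \<epsilon>))"

lemma omega_holder_space_iff:
  "f \<in> omega_holder_space \<alpha> \<longleftrightarrow> f \<in> holder_space \<alpha> \<and>
     (\<forall>\<epsilon>>0. \<exists>F. finite F \<and> F \<subseteq> {0..1} \<and> oscillation_le_off F f \<epsilon>)"
  by (simp add: omega_holder_space_def oscillation_le_off_def)

lemma oscillation_le_off_mono:
  assumes "oscillation_le_off F f a"
    and "\<And>x y. \<lbrakk>x \<in> {0..1}; y \<in> {0..1}; x \<noteq> y; holder_quot \<alpha> f x y \<le> a\<rbrakk> \<Longrightarrow> holder_quot \<alpha> g x y \<le> b"
  shows "oscillation_le_off F g b"
  unfolding oscillation_le_off_def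
proof
  fix t assume "t \<in> {0..1} - F"
  then obtain U where U: "openin (top_of_set {0..1}) U" "t \<in> U"
    "\<forall>x\<in>U. \<forall>y\<in>U. x \<noteq> y \<longrightarrow> holder_quot \<alpha> f x y \<le> a"
    using assms(1) unfolding oscillation_le_off_def by meson
  have "U \<subseteq> {0..1}" using openin_subset[OF U(1)] by simp
  then have "\<forall>x\<in>U. \<forall>y\<in>U. x \<noteq> y \<longrightarrow> holder_quot \<alpha> g x y \<le> b"
    using U(3) assms(2) by (meson subsetD)
  then show "\<exists>U. openin (top_of_set {0..1}) U \<and> t \<in> U \<and>
      (\<forall>x\<in>U. \<forall>y\<in>U. x \<noteq> y \<longrightarrow> holder_quot \<alpha> g x y \<le> b)"
    using U(1,2) by meson
qed

lemma oscillation_le_off_add: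
  assumes "oscillation_le_off F f a" "oscillation_le_off G g b"
  shows "oscillation_le_off (F \<union> G) (f + g) (a + b)"
  unfolding oscillation_le_off_def
proof
  fix t assume t: "t \<in> {0..1} - (F \<union> G)"
  obtain A where A: "openin (top_of_set {0..1}) A" "t \<in> A"
    "\<forall>x\<in>A. \<forall>y\<in>A. x \<noteq> y \<longrightarrow> holder_quot \<alpha> f x y \<le> a"
    using bspec[OF assms(1)[unfolded oscillation_le_off_def], of t] t by auto
  obtain B where B: "openin (top_of_set {0..1}) B" "t \<in> B"
    "\<forall>x\<in>B. \<forall>y\<in>B. x \<noteq> y \<longrightarrow> holder_quot \<alpha> g x y \<le> b"
    using bspec[OF assms(2)[unfolded oscillation_le_off_def], of t] t by auto
  have "holder_quot \<alpha> (f + g) x y \<le> a + b" if "x \<in> A \<inter> B" "y \<in> A \<inter> B" "x \<noteq> y" for x y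
  proof -
    have "holder_quot \<alpha> f x y \<le> a" "holder_quot \<alpha> g x y \<le> b" using A(3) B(3) that by auto
    then show ?thesis using holder_quot_add[of f g x y] by linarith
  qed
  then show "\<exists>U. openin (top_of_set {0..1}) U \<and> t \<in> U \<and>
      (\<forall>x\<in>U. \<forall>y\<in>U. x \<noteq> y \<longrightarrow> holder_quot \<alpha> (f + g) x y \<le> a + b)"
    using A(1,2) B(1,2) by (intro exI[of _ "A \<inter> B"]) (simp add: openin_Int)
qed

lemma little_subset_omega: "little_holder_space \<alpha> \<subseteq> omega_holder_space \<alpha>"
proof
  fix f :: "real \<Rightarrow> 'a" assume f: "f \<in> little_holder_space \<alpha>"
  have "\<exists>U. openin (top_of_set {0..1}) U \<and> t \<in> U \<and>
      (\<forall>x\<in>U. \<forall>y\<in>U. x \<noteq> y \<longrightarrow> holder_quot \<alpha> f x y \<le> \<epsilon>)" if \<epsilon>: "\<epsilon> > 0" and t: "t \<in> {0..1}" for \<epsilon> t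
  proof -
    obtain \<delta> where \<delta>: "\<delta> > 0" "\<And>x y. \<lbrakk>x \<in> {0..1}; y \<in> {0..1}; x \<noteq> y; \<bar>x - y\<bar> < \<delta>\<rbrakk> \<Longrightarrow> holder_quot \<alpha> f x y < \<epsilon>"
      using little_holderE[OF f \<epsilon>] by metis
    have "holder_quot \<alpha> f x y \<le> \<epsilon>"
      if "x \<in> {0..1} \<inter> ball t (\<delta> / 2)" "y \<in> {0..1} \<inter> ball t (\<delta> / 2)" "x \<noteq> y" for x y
    proof -
      have "\<bar>t - x\<bar> < \<delta> / 2" "\<bar>t - y\<bar> < \<delta> / 2" using that by (simp_all add: dist_real_def)
      then have "\<bar>x - y\<bar> < \<delta>" by linarith
      then show ?thesis using \<delta>(2)[of x y] that by simp
    qed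
    moreover have "openin (top_of_set {0..1}) ({0..1} \<inter> ball t (\<delta> / 2))"
      by (intro openin_open_Int open_ball)
    moreover have "t \<in> {0..1} \<inter> ball t (\<delta> / 2)" using t \<delta>(1) by simp
    ultimately show ?thesis by meson
  qed
  then have "oscillation_le_off {} f \<epsilon>" if "\<epsilon> > 0" for \<epsilon>
    using that unfolding oscillation_le_off_def by simp
  then show "f \<in> omega_holder_space \<alpha>"
    using f by (auto simp: omega_holder_space_iff little_holder_space_def intro: exI[of _ "{}"])
qed

lemma little_approximable:
  fixes f :: "real \<Rightarrow> 'k::real_normed_field"
  assumes f: "f \<in> holder_space \<alpha>" and ap: "\<And>\<epsilon>. \<epsilon> > 0 \<Longrightarrow> \<exists>g\<in>little_holder_space \<alpha>. Lip (f - g) < \<epsilon>"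
  shows "f \<in> little_holder_space \<alpha>"
proof -
  have "\<exists>\<delta>>0. \<forall>x\<in>{0..1}. \<forall>y\<in>{0..1}. x \<noteq> y \<and> \<bar>x - y\<bar> < \<delta> \<longrightarrow> holder_quot \<alpha> f x y < \<epsilon>"
    if \<epsilon>: "\<epsilon> > 0" for \<epsilon>
  proof -
    obtain g where g: "g \<in> little_holder_space \<alpha>" "Lip (f - g) < \<epsilon> / 2"
      using ap[of "\<epsilon> / 2"] \<epsilon> by auto
    then have gH: "g \<in> holder_space \<alpha>" using little_subset_holder by blast
    obtain \<delta> where \<delta>: "\<delta> > 0"
      "\<And>x y. \<lbrakk>x \<in> {0..1}; y \<in> {0..1}; x \<noteq> y; \<bar>x - y\<bar> < \<delta>\<rbrakk> \<Longrightarrow> holder_quot \<alpha> g x y < \<epsilon> / 2"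
      using little_holderE[OF g(1) half_gt_zero[OF \<epsilon>]] by metis
    then have "holder_quot \<alpha> f x y < \<epsilon>" if "x \<in> {0..1}" "y \<in> {0..1}" "x \<noteq> y" "\<bar>x - y\<bar> < \<delta>" for x y
      using holder_quot_perturb[OF f gH that(1-3)] g(2) \<delta>(2)[OF that] by linarith
    then show ?thesis using \<delta>(1) by blast
  qed
  then show ?thesis using f by (simp add: little_holder_space_def)
qed

lemma omega_approximable:
  fixes f :: "real \<Rightarrow> 'k::real_normed_field"
  assumes f: "f \<in> holder_space \<alpha>" and ap: "\<And>\<epsilon>. \<epsilon> > 0 \<Longrightarrow> \<exists>g\<in>omega_holder_space \<alpha>. Lip (f - g) < \<epsilon>"
  shows "f \<in> omega_holder_space \<alpha>"
proof -
  have "\<exists>F. finite F \<and> F \<subseteq> {0..1} \<and> oscillation_le_off F f \<epsilon>" if \<epsilon>: "\<epsilon> > 0" for \<epsilon>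
  proof -
    obtain g where g: "g \<in> omega_holder_space \<alpha>" "Lip (f - g) < \<epsilon> / 2"
      using ap[of "\<epsilon> / 2"] \<epsilon> by auto
    then have gH: "g \<in> holder_space \<alpha>" using omega_subset_holder by blast
    obtain F where F: "finite F" "F \<subseteq> {0..1}" "oscillation_le_off F g (\<epsilon> / 2)"
      using g(1) half_gt_zero[OF \<epsilon>] unfolding omega_holder_space_iff by blast
    have "holder_quot \<alpha> f x y \<le> \<epsilon>"
      if "x \<in> {0..1}" "y \<in> {0..1}" "x \<noteq> y" "holder_quot \<alpha> g x y \<le> \<epsilon> / 2" for x y
      using holder_quot_perturb[OF f gH that(1-3)] that(4) g(2) by linarith
    then have "oscillation_le_off F f \<epsilon>"
      by (rule oscillation_le_off_mono[OF F(3)])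
    then show ?thesis using F by blast
  qed
  then show ?thesis using f by (simp add: omega_holder_space_iff)
qed

lemma little_subspace: "H.subspace (little_holder_space \<alpha> :: (real \<Rightarrow> 'k::real_normed_field) set)"
proof -
  have "f + g \<in> little_holder_space \<alpha>"
    if f: "f \<in> little_holder_space \<alpha>" and g: "g \<in> little_holder_space \<alpha>" for f g :: "real \<Rightarrow> 'k"
  proof -
    have "\<exists>\<delta>>0. \<forall>x\<in>{0..1}. \<forall>y\<in>{0..1}. x \<noteq> y \<and> \<bar>x - y\<bar> < \<delta> \<longrightarrow> holder_quot \<alpha> (f + g) x y < \<epsilon>"
      if \<epsilon>: "\<epsilon> > 0" for \<epsilon>
    proof -
      obtain \<delta> where \<delta>: "\<delta> > 0"
        "\<And>x y. \<lbrakk>x \<in> {0..1}; y \<in> {0..1}; x \<noteq> y; \<bar>x - y\<bar> < \<delta>\<rbrakk> \<Longrightarrow> holder_quot \<alpha> f x y < \<epsilon> / 2"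
        using little_holderE[OF f half_gt_zero[OF \<epsilon>]] by metis
      obtain \<eta> where \<eta>: "\<eta> > 0"
        "\<And>x y. \<lbrakk>x \<in> {0..1}; y \<in> {0..1}; x \<noteq> y; \<bar>x - y\<bar> < \<eta>\<rbrakk> \<Longrightarrow> holder_quot \<alpha> g x y < \<epsilon> / 2"
        using little_holderE[OF g half_gt_zero[OF \<epsilon>]] by metis
      have "holder_quot \<alpha> (f + g) x y < \<epsilon>"
        if "x \<in> {0..1}" "y \<in> {0..1}" "x \<noteq> y" "\<bar>x - y\<bar> < min \<delta> \<eta>" for x y
        using holder_quot_add[of f g x y] \<delta>(2)[of x y] \<eta>(2)[of x y] that by simp
      then show ?thesis using \<delta>(1) \<eta>(1) by (intro exI[of _ "min \<delta> \<eta>"]) auto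
    qed
    then show ?thesis
      using f g holder_add by (auto simp: little_holder_space_def)
  qed
  moreover have "fun_scale c f \<in> little_holder_space \<alpha>" if f: "f \<in> little_holder_space \<alpha>"
    for c and f :: "real \<Rightarrow> 'k"
  proof -
    have "\<exists>\<delta>>0. \<forall>x\<in>{0..1}. \<forall>y\<in>{0..1}. x \<noteq> y \<and> \<bar>x - y\<bar> < \<delta> \<longrightarrow> holder_quot \<alpha> (fun_scale c f) x y < \<epsilon>"
      if \<epsilon>: "\<epsilon> > 0" for \<epsilon>
    proof -
      have "\<epsilon> / (norm c + 1) > 0" using \<epsilon> by (simp add: add_nonneg_pos)
      then obtain \<delta> where \<delta>: "\<delta> > 0"
        "\<And>x y. \<lbrakk>x \<in> {0..1}; y \<in> {0..1}; x \<noteq> y; \<bar>x - y\<bar> < \<delta>\<rbrakk> \<Longrightarrow> holder_quot \<alpha> f x y < \<epsilon> / (norm c + 1)"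
        using little_holderE[OF f] by metis
      have "holder_quot \<alpha> (fun_scale c f) x y < \<epsilon>"
        if "x \<in> {0..1}" "y \<in> {0..1}" "x \<noteq> y" "\<bar>x - y\<bar> < \<delta>" for x y
      proof -
        have "norm c * holder_quot \<alpha> f x y \<le> (norm c + 1) * holder_quot \<alpha> f x y"
          by (intro mult_right_mono) (auto simp: holder_quot_def)
        also have "\<dots> < \<epsilon>"
          using \<delta>(2) that by (simp add: pos_less_divide_eq add_nonneg_pos mult.commute)
        finally show ?thesis by (simp add: holder_quot_scale)
      qed
      then show ?thesis using \<delta>(1) by blast
    qed
    then show ?thesis
      using f holder_scale by (auto simp: little_holder_space_def)
  qed
  moreover have "(0 :: real \<Rightarrow> 'k) \<in> little_holder_space \<alpha>"
    using holder_zero by (auto simp: little_holder_space_def holder_quot_def intro!: exI[of _ 1])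
  ultimately show ?thesis by (simp add: H.subspace_def)
qed

lemma omega_subspace: "H.subspace (omega_holder_space \<alpha> :: (real \<Rightarrow> 'k::real_normed_field) set)"
proof -
  have "f + g \<in> omega_holder_space \<alpha>"
    if f: "f \<in> omega_holder_space \<alpha>" and g: "g \<in> omega_holder_space \<alpha>" for f g :: "real \<Rightarrow> 'k"
  proof -
    have "\<exists>F. finite F \<and> F \<subseteq> {0..1} \<and> oscillation_le_off F (f + g) \<epsilon>" if \<epsilon>: "\<epsilon> > 0" for \<epsilon>
    proof -
      obtain F G where "finite F" "F \<subseteq> {0..1}" "oscillation_le_off F f (\<epsilon> / 2)"
        and "finite G" "G \<subseteq> {0..1}" "oscillation_le_off G g (\<epsilon> / 2)"
        using f g half_gt_zero[OF \<epsilon>] unfolding omega_holder_space_iff by meson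
      then show ?thesis
        using oscillation_le_off_add[of F f "\<epsilon> / 2" G g "\<epsilon> / 2"]
        by (intro exI[of _ "F \<union> G"]) simp
    qed
    then show ?thesis
      using f g holder_add(1) unfolding omega_holder_space_iff by blast
  qed
  moreover have "fun_scale c f \<in> omega_holder_space \<alpha>" if f: "f \<in> omega_holder_space \<alpha>"
    for c and f :: "real \<Rightarrow> 'k"
  proof -
    have "\<exists>F. finite F \<and> F \<subseteq> {0..1} \<and> oscillation_le_off F (fun_scale c f) \<epsilon>" if \<epsilon>: "\<epsilon> > 0" for \<epsilon>
    proof -
      have e: "\<epsilon> / (norm c + 1) > 0" using \<epsilon> by (simp add: add_nonneg_pos)
      have "holder_quot \<alpha> (fun_scale c f) x y \<le> \<epsilon>"
        if "holder_quot \<alpha> f x y \<le> \<epsilon> / (norm c + 1)" for x y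
      proof -
        have "norm c * holder_quot \<alpha> f x y \<le> (norm c + 1) * holder_quot \<alpha> f x y"
          by (intro mult_right_mono) (auto simp: holder_quot_def)
        also have "\<dots> \<le> \<epsilon>"
          using that by (simp add: pos_le_divide_eq add_nonneg_pos mult.commute)
        finally show ?thesis by (simp add: holder_quot_scale)
      qed
      moreover obtain F where "finite F" "F \<subseteq> {0..1}" "oscillation_le_off F f (\<epsilon> / (norm c + 1))"
        using f e unfolding omega_holder_space_iff by meson
      ultimately show ?thesis using oscillation_le_off_mono by meson
    qed
    then show ?thesis
      using f holder_scale(1) unfolding omega_holder_space_iff by blast
  qed
  moreover have "(0 :: real \<Rightarrow> 'k) \<in> omega_holder_space \<alpha>"
    using H.subspace_0[OF little_subspace] little_subset_omega by blast
  ultimately show ?thesis by (simp add: H.subspace_def)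
qed

lemma omega_normed_space:
  "normed_space_on fun_scale (omega_holder_space \<alpha> :: (real \<Rightarrow> 'k::real_normed_field) set) Lip"
proof -
  have "f \<in> holder_space \<alpha>" if "f \<in> omega_holder_space \<alpha>" for f :: "real \<Rightarrow> 'k"
    using that omega_subset_holder by blast
  then show ?thesis
    using omega_subspace
    by unfold_locales (simp_all add: H.norm_nonneg H.norm_eq_0_iff H.norm_scale H.norm_triangle)
qed

lemma omega_banach:
  "banach_space_on fun_scale (omega_holder_space \<alpha> :: (real \<Rightarrow> 'k::{real_normed_field,banach}) set) Lip"
proof -
  interpret W: normed_space_on fun_scale "omega_holder_space \<alpha> :: (real \<Rightarrow> 'k) set" Lip
    by (rule omega_normed_space)
  show ?thesis
  proof (unfold_locales, rule W.mcompleteI)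
    fix f :: "nat \<Rightarrow> real \<Rightarrow> 'k"
    assume f: "range f \<subseteq> omega_holder_space \<alpha>"
      and "\<And>\<epsilon>. \<epsilon> > 0 \<Longrightarrow> \<exists>M. \<forall>m\<ge>M. \<forall>n\<ge>M. Lip (f m - f n) < \<epsilon>"
    moreover have fH: "f n \<in> holder_space \<alpha>" for n using f omega_subset_holder by auto
    ultimately obtain g where g: "g \<in> holder_space \<alpha>" "\<And>\<epsilon>. \<epsilon> > 0 \<Longrightarrow> \<exists>M. \<forall>n\<ge>M. Lip (f n - g) < \<epsilon>"
      using holder_complete[of f] by blast
    have "\<exists>h\<in>omega_holder_space \<alpha>. Lip (g - h) < \<epsilon>" if \<epsilon>: "\<epsilon> > 0" for \<epsilon>
    proof -
      obtain M where "Lip (f M - g) < \<epsilon>" using g(2)[OF \<epsilon>] by blast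
      then show ?thesis
        using f H.norm_minus_commute_on[OF g(1) fH, of M] by (intro bexI[of _ "f M"]) auto
    qed
    then have "g \<in> omega_holder_space \<alpha>" by (rule omega_approximable[OF g(1)])
    then show "\<exists>g\<in>omega_holder_space \<alpha>. \<forall>\<epsilon>>0. \<exists>M. \<forall>n\<ge>M. Lip (f n - g) < \<epsilon>"
      using g(2) by blast
  qed
qed

lemma little_closed_subspace:
  "closed_subspace_on fun_scale (omega_holder_space \<alpha>) Lip
     (little_holder_space \<alpha> :: (real \<Rightarrow> 'k::real_normed_field) set)"
proof -
  interpret W: normed_space_on fun_scale "omega_holder_space \<alpha> :: (real \<Rightarrow> 'k) set" Lip
    by (rule omega_normed_space)
  show ?thesis
    unfolding closed_subspace_on_def W.closedin_iff_approximable
    using little_subspace little_subset_omega little_approximable omega_subset_holder by blast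
qed

end

section \<open>Window averages\<close>

definition window_mean :: "real \<Rightarrow> (real \<Rightarrow> 'k::banach) \<Rightarrow> real \<Rightarrow> 'k" where
  "window_mean h f a = (1 / h) *\<^sub>R integral {a..a + h} f"

lemma window_mean_add:
  assumes "continuous_on {a..a + h} f" "continuous_on {a..a + h} g"
  shows "window_mean h (f + g) a = window_mean h f a + window_mean h g a"
  using integral_add[OF integrable_continuous_real[OF assms(1)] integrable_continuous_real[OF assms(2)]]
  by (simp add: window_mean_def plus_fun_def scaleR_add_right)

lemma window_mean_scale:
  fixes f :: "real \<Rightarrow> 'k::{real_normed_field,banach}"
  assumes "continuous_on {a..a + h} f"
  shows "window_mean h (fun_scale c f) a = c * window_mean h f a"
  using integral_linear[OF integrable_continuous_real[OF assms] bounded_linear_mult_right[of c]]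
  by (simp add: window_mean_def fun_scale_def o_def)

lemma window_mean_const: "0 < h \<Longrightarrow> window_mean h (\<lambda>_. c) a = c"
  by (simp add: window_mean_def)

text \<open>
  All size estimates for averages are comparisons of two windows of equal length, parametrised
  simultaneously; taking \<open>g\<close> constant also compares an average with a single value.
\<close>

lemma norm_window_mean_diff_le:
  assumes h: "0 < h"
    and f: "continuous_on {a..a + h} f" and g: "continuous_on {b..b + h} g"
    and B: "\<And>t. t \<in> {0..h} \<Longrightarrow> norm (f (a + t) - g (b + t)) \<le> B"
  shows "norm (window_mean h f a - window_mean h g b) \<le> B"
proof -
  have cont: "continuous_on {0..h} (\<lambda>t. f (a + t))" "continuous_on {0..h} (\<lambda>t. g (b + t))"
    by (intro continuous_on_compose2[OF f] continuous_on_compose2[OF g] continuous_intros; simp)+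
  have shift: "integral {a..a + h} f = integral {0..h} (\<lambda>t. f (a + t))"
    "integral {b..b + h} g = integral {0..h} (\<lambda>t. g (b + t))"
    using integral_shift_Icc_real[of 0 h f a] integral_shift_Icc_real[of 0 h g b]
    by (simp_all add: o_def add.commute)
  have "integral {a..a + h} f - integral {b..b + h} g = integral {0..h} (\<lambda>t. f (a + t) - g (b + t))"
    unfolding shift by (intro integral_diff[symmetric] integrable_continuous_real cont)
  also have "norm \<dots> \<le> B * (h - 0)"
    using h B by (intro integral_bound continuous_intros cont) auto
  finally have "norm (integral {a..a + h} f - integral {b..b + h} g) \<le> B * h" by simp
  then show ?thesis
    using h by (simp add: window_mean_def pos_divide_le_eq flip: scaleR_diff_right)
qed

text \<open>
  For overlapping windows the common part cancels. What remains is the difference of two integrals over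
  intervals of length \<open>b - a\<close> that are translates of each other by \<open>h\<close>, which is how the factor
  \<open>(b - a) / h\<close> arises.
\<close>

lemma window_mean_translate_le:
  assumes ab: "a < b" and h: "0 < h"
    and f: "continuous_on {a..b + h} f"
    and B: "\<And>t. t \<in> {a..b} \<Longrightarrow> norm (f (t + h) - f t) \<le> B"
  shows "norm (window_mean h f b - window_mean h f a) \<le> (b - a) / h * B"
proof -
  have int: "f integrable_on {c..d}" if "a \<le> c" "d \<le> b + h" for c d
    using that by (intro integrable_continuous_real continuous_on_subset[OF f]) auto
  have "integral {a..a + h} f + integral {a + h..b + h} f = integral {a..b + h} f"
    "integral {a..b} f + integral {b..b + h} f = integral {a..b + h} f"
    using ab h by (intro Henstock_Kurzweil_Integration.integral_combine int; simp)+
  then have "integral {b..b + h} f - integral {a..a + h} f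
      = integral {a + h..b + h} f - integral {a..b} f"
    by (simp add: algebra_simps)
  also have "\<dots> = (b - a) *\<^sub>R (window_mean (b - a) f (a + h) - window_mean (b - a) f a)"
    using ab by (simp add: window_mean_def scaleR_diff_right add.commute)
  finally have eq: "window_mean h f b - window_mean h f a =
      ((b - a) / h) *\<^sub>R (window_mean (b - a) f (a + h) - window_mean (b - a) f a)"
    by (simp add: window_mean_def flip: scaleR_diff_right)
  have "norm (window_mean (b - a) f (a + h) - window_mean (b - a) f a) \<le> B"
  proof (rule norm_window_mean_diff_le)
    show "norm (f (a + h + t) - f (a + t)) \<le> B" if "t \<in> {0..b - a}" for t
      using B[of "a + t"] that by (simp add: add.commute add.left_commute)
  qed (use ab h in \<open>auto intro!: continuous_on_subset[OF f]\<close>)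
  then show ?thesis
    unfolding eq using ab h by (simp add: divide_right_mono mult_left_mono)
qed

text \<open>
  Averaging over \<open>{(1 - h) * x..(1 - h) * x + h}\<close> with \<open>h = (1/2) ^ n\<close>, rather than over \<open>{x..x + h}\<close>,
  keeps the window inside the unit interval, and the contraction \<open>x \<mapsto> (1 - h) * x\<close> does not increase
  Hoelder constants. Subtracting the average at 0 restores the normalisation at 0.
\<close>

definition smooth :: "nat \<Rightarrow> (real \<Rightarrow> 'k::banach) \<Rightarrow> real \<Rightarrow> 'k" where
  "smooth n f x = (if x \<in> {0..1}
     then window_mean ((1/2) ^ n) f ((1 - (1/2) ^ n) * x) - window_mean ((1/2) ^ n) f 0 else 0)"

lemma window_in_unit_interval:
  fixes h x t :: real
  assumes "0 \<le> h" "h \<le> 1" "x \<in> {0..1}" "t \<in> {0..h}"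
  shows "(1 - h) * x + t \<in> {0..1}"
proof -
  have "(1 - h) * x \<le> (1 - h) * 1" using assms by (intro mult_left_mono) auto
  moreover have "0 \<le> (1 - h) * x" using assms by simp
  ultimately show ?thesis using assms by simp
qed

lemma dist_window_le:
  fixes h x t :: real
  assumes "0 \<le> h" "x \<in> {0..1}" "t \<in> {0..h}"
  shows "\<bar>(1 - h) * x + t - x\<bar> \<le> h"
proof -
  have "0 \<le> h * x" "h * x \<le> h * 1" using assms by (simp, intro mult_left_mono) auto
  moreover have eq: "(1 - h) * x + t - x = t - h * x" by (simp add: algebra_simps)
  moreover have "0 \<le> t" "t \<le> h" using assms by auto
  ultimately show ?thesis unfolding eq by linarith
qed

lemma window_subset_unit_interval:
  fixes h x :: real
  assumes "0 \<le> h" "h \<le> 1" "x \<in> {0..1}"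
  shows "{(1 - h) * x..(1 - h) * x + h} \<subseteq> {0..1}"
  using window_in_unit_interval[OF assms, of 0] window_in_unit_interval[OF assms, of h] assms by auto

section \<open>Smoothing of Hoelder functions\<close>

context holder_exponent
begin

lemma holder_continuous:
  fixes f :: "real \<Rightarrow> 'k::real_normed_field"
  assumes f: "f \<in> holder_space \<alpha>"
  shows "continuous_on {0..1} f"
proof (rule continuous_onI)
  fix x e :: real assume x: "x \<in> {0..1}" and e: "e > 0"
  obtain \<delta> where \<delta>: "\<delta> > 0" "\<forall>d. 0 \<le> d \<longrightarrow> d < \<delta> \<longrightarrow> Lip f * d powr \<alpha> < e"
    using small_powr[OF holder_norm_nonneg[OF f] \<alpha>(1) e] by blast
  have "dist (f y) (f x) \<le> e" if "y \<in> {0..1}" "dist y x < \<delta>" for y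
  proof -
    have "norm (f y - f x) \<le> Lip f * \<bar>y - x\<bar> powr \<alpha>" by (rule holder_bound[OF f that(1) x])
    also have "\<dots> < e" using \<delta>(2) that(2) by (simp add: dist_real_def)
    finally show ?thesis by (simp add: dist_norm)
  qed
  then show "\<exists>\<delta>>0. \<forall>y\<in>{0..1}. dist y x < \<delta> \<longrightarrow> dist (f y) (f x) \<le> e"
    using \<delta>(1) by blast
qed

context
  fixes n :: nat and h :: real
  defines "h \<equiv> (1/2) ^ n"
begin

lemma h_bounds: "0 < h" "0 \<le> h" "h \<le> 1"
  by (auto simp: h_def power_le_one)

lemma smooth_eq: "x \<in> {0..1} \<Longrightarrow> smooth n f x = window_mean h f ((1 - h) * x) - window_mean h f 0"
  by (simp add: smooth_def h_def)

lemma smooth_outside: "x \<notin> {0..1} \<Longrightarrow> smooth n f x = 0"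
  and smooth_0: "smooth n f 0 = 0"
  by (auto simp: smooth_def)

lemma continuous_on_window:
  assumes "f \<in> holder_space \<alpha>" "x \<in> {0..1}"
  shows "continuous_on {(1 - h) * x..(1 - h) * x + h} f"
  using holder_continuous[OF assms(1)] window_subset_unit_interval[OF h_bounds(2,3) assms(2)]
  by (rule continuous_on_subset)

lemma continuous_on_window_0:
  assumes "f \<in> holder_space \<alpha>"
  shows "continuous_on {0..0 + h} f"
  using continuous_on_window[OF assms, of 0] by simp

text \<open>
  The hypothesis is restricted to points that are no farther apart than \<open>x\<close> and \<open>y\<close>, so that the lemma
  yields the contraction property as well as the preservation of small difference quotients at small
  distances.
\<close>

lemma norm_smooth_diff_le:
  fixes f :: "real \<Rightarrow> 'k::{real_normed_field,banach}"
  assumes f: "f \<in> holder_space \<alpha>" and xy: "x \<in> {0..1}" "y \<in> {0..1}"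
    and B: "\<And>a b. \<lbrakk>a \<in> {0..1}; b \<in> {0..1}; \<bar>a - b\<bar> \<le> \<bar>x - y\<bar>\<rbrakk> \<Longrightarrow> norm (f a - f b) \<le> c * \<bar>a - b\<bar> powr \<alpha>"
    and c: "0 \<le> c"
  shows "norm (smooth n f x - smooth n f y) \<le> c * \<bar>x - y\<bar> powr \<alpha>"
proof -
  have "norm (window_mean h f ((1 - h) * x) - window_mean h f ((1 - h) * y)) \<le> c * \<bar>x - y\<bar> powr \<alpha>"
  proof (rule norm_window_mean_diff_le[OF h_bounds(1)])
    fix t assume t: "t \<in> {0..h}"
    have "\<bar>(1 - h) * x + t - ((1 - h) * y + t)\<bar> = (1 - h) * \<bar>x - y\<bar>"
      using h_bounds by (simp add: abs_mult flip: right_diff_distrib)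
    also have "\<dots> \<le> 1 * \<bar>x - y\<bar>" using h_bounds by (intro mult_right_mono) auto
    finally have d: "\<bar>(1 - h) * x + t - ((1 - h) * y + t)\<bar> \<le> \<bar>x - y\<bar>" by simp
    have "norm (f ((1 - h) * x + t) - f ((1 - h) * y + t)) \<le>
        c * \<bar>(1 - h) * x + t - ((1 - h) * y + t)\<bar> powr \<alpha>"
      by (intro B d window_in_unit_interval h_bounds xy t)
    also have "\<dots> \<le> c * \<bar>x - y\<bar> powr \<alpha>"
      using d \<alpha> c by (intro mult_left_mono powr_mono2) auto
    finally show "norm (f ((1 - h) * x + t) - f ((1 - h) * y + t)) \<le> c * \<bar>x - y\<bar> powr \<alpha>" .
  qed (intro continuous_on_window f xy)+
  then show ?thesis using xy by (simp add: smooth_eq)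
qed

lemma smooth_holder:
  fixes f :: "real \<Rightarrow> 'k::{real_normed_field,banach}"
  assumes f: "f \<in> holder_space \<alpha>"
  shows "smooth n f \<in> holder_space \<alpha>" "Lip (smooth n f) \<le> Lip f"
  using norm_smooth_diff_le[OF f _ _ holder_bound[OF f] holder_norm_nonneg[OF f]]
  by (intro holder_spaceI[of "smooth n f" "Lip f"] smooth_outside smooth_0; simp)+

text \<open>
  Smoothings are Lipschitz, with a constant that grows with \<open>n\<close> because the exponent \<open>\<alpha> - 1\<close> is
  negative; at distances below \<open>h\<close> this beats the Hoelder bound.
\<close>

lemma smooth_lipschitz:
  fixes f :: "real \<Rightarrow> 'k::{real_normed_field,banach}"
  assumes f: "f \<in> holder_space \<alpha>" and xy: "x \<in> {0..1}" "y \<in> {0..1}"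
  shows "norm (smooth n f x - smooth n f y) \<le> Lip f * h powr (\<alpha> - 1) * \<bar>x - y\<bar>"
proof -
  have *: "norm (window_mean h f ((1 - h) * b) - window_mean h f ((1 - h) * a))
      \<le> Lip f * h powr (\<alpha> - 1) * (b - a)"
    if ab: "a \<in> {0..1}" "b \<in> {0..1}" "a \<le> b" for a b
  proof (cases "(1 - h) * a = (1 - h) * b")
    case True
    have "0 \<le> Lip f * h powr (\<alpha> - 1) * (b - a)" using holder_norm_nonneg[OF f] ab by simp
    then show ?thesis unfolding True by simp
  next
    case False
    then have less: "(1 - h) * a < (1 - h) * b"
      using mult_left_mono[OF ab(3), of "1 - h"] h_bounds by simp
    have sub: "{(1 - h) * a..(1 - h) * b + h} \<subseteq> {0..1}"
      using window_in_unit_interval[OF h_bounds(2,3) ab(1), of 0]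
        window_in_unit_interval[OF h_bounds(2,3) ab(2), of h] h_bounds by auto
    have "norm (window_mean h f ((1 - h) * b) - window_mean h f ((1 - h) * a))
        \<le> ((1 - h) * b - (1 - h) * a) / h * (Lip f * h powr \<alpha>)"
    proof (rule window_mean_translate_le[OF less h_bounds(1) continuous_on_subset[OF holder_continuous[OF f] sub]])
      fix t assume "t \<in> {(1 - h) * a..(1 - h) * b}"
      then have "t \<in> {0..1}" "t + h \<in> {0..1}" using sub h_bounds by auto
      then show "norm (f (t + h) - f t) \<le> Lip f * h powr \<alpha>"
        using holder_bound[OF f, of "t + h" t] h_bounds by simp
    qed
    also have "\<dots> \<le> (b - a) / h * (Lip f * h powr \<alpha>)"
    proof -
      have "(1 - h) * b - (1 - h) * a = (1 - h) * (b - a)" by (simp add: algebra_simps)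
      also have "\<dots> \<le> 1 * (b - a)" using ab h_bounds by (intro mult_right_mono) auto
      finally show ?thesis
        using h_bounds holder_norm_nonneg[OF f] by (intro mult_right_mono divide_right_mono) auto
    qed
    also have "\<dots> = Lip f * h powr (\<alpha> - 1) * (b - a)"
      using h_bounds(1) by (simp add: powr_diff)
    finally show ?thesis .
  qed
  show ?thesis
  proof (cases "x \<le> y")
    case True
    then show ?thesis using *[of x y] xy by (simp add: smooth_eq norm_minus_commute)
  next
    case False
    then show ?thesis using *[of y x] xy by (simp add: smooth_eq)
  qed
qed

lemma smooth_close:
  fixes f :: "real \<Rightarrow> 'k::{real_normed_field,banach}"
  assumes f: "f \<in> holder_space \<alpha>" and x: "x \<in> {0..1}"
  shows "norm (smooth n f x - f x) \<le> 2 * Lip f * h powr \<alpha>"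
proof -
  have *: "norm (window_mean h f ((1 - h) * a) - f a) \<le> Lip f * h powr \<alpha>" if a: "a \<in> {0..1}" for a
  proof -
    have "norm (window_mean h f ((1 - h) * a) - window_mean h (\<lambda>_. f a) 0) \<le> Lip f * h powr \<alpha>"
    proof (rule norm_window_mean_diff_le[OF h_bounds(1)])
      fix t assume t: "t \<in> {0..h}"
      have "norm (f ((1 - h) * a + t) - f a) \<le> Lip f * \<bar>(1 - h) * a + t - a\<bar> powr \<alpha>"
        by (intro holder_bound f window_in_unit_interval h_bounds a t)
      also have "\<dots> \<le> Lip f * h powr \<alpha>"
        using dist_window_le[OF h_bounds(2) a t] \<alpha> holder_norm_nonneg[OF f]
        by (intro mult_left_mono powr_mono2) auto
      finally show "norm (f ((1 - h) * a + t) - f a) \<le> Lip f * h powr \<alpha>" .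
    qed (intro continuous_on_window f a continuous_intros)+
    then show ?thesis using h_bounds by (simp add: window_mean_const)
  qed
  have "norm (smooth n f x - f x) \<le> norm (window_mean h f ((1 - h) * x) - f x) + norm (window_mean h f ((1 - h) * 0) - f 0)"
    using norm_triangle_ineq4[of "window_mean h f ((1 - h) * x) - f x" "window_mean h f ((1 - h) * 0) - f 0"]
      holder_spaceD(2)[OF f] x by (simp add: smooth_eq algebra_simps)
  also have "\<dots> \<le> Lip f * h powr \<alpha> + Lip f * h powr \<alpha>"
    by (intro add_mono * x) auto
  finally show ?thesis by simp
qed

lemma smooth_add:
  fixes f g :: "real \<Rightarrow> 'k::{real_normed_field,banach}"
  assumes "f \<in> holder_space \<alpha>" "g \<in> holder_space \<alpha>"
  shows "smooth n (f + g) = smooth n f + smooth n g"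
proof
  fix x
  show "smooth n (f + g) x = (smooth n f + smooth n g) x"
  proof (cases "x \<in> {0..1}")
    case True
    then show ?thesis
      using window_mean_add[OF continuous_on_window[OF assms(1) True] continuous_on_window[OF assms(2) True]]
        window_mean_add[OF continuous_on_window_0[OF assms(1)] continuous_on_window_0[OF assms(2)]]
      by (simp add: smooth_eq)
  qed (simp add: smooth_outside)
qed

lemma smooth_scale:
  fixes f :: "real \<Rightarrow> 'k::{real_normed_field,banach}"
  assumes "f \<in> holder_space \<alpha>"
  shows "smooth n (fun_scale c f) = fun_scale c (smooth n f)"
proof
  fix x
  show "smooth n (fun_scale c f) x = fun_scale c (smooth n f) x"
  proof (cases "x \<in> {0..1}")
    case True
    then show ?thesis
      using window_mean_scale[OF continuous_on_window[OF assms True], of c]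
        window_mean_scale[OF continuous_on_window_0[OF assms], of c]
      unfolding fun_scale_def[of c "smooth n f"]
      by (simp add: smooth_eq right_diff_distrib)
  qed (simp add: smooth_outside fun_scale_def)
qed

lemma smooth_little:
  fixes f :: "real \<Rightarrow> 'k::{real_normed_field,banach}"
  assumes f: "f \<in> holder_space \<alpha>"
  shows "smooth n f \<in> little_holder_space \<alpha>"
proof -
  define c where "c = Lip f * h powr (\<alpha> - 1)"
  have c: "0 \<le> c" using holder_norm_nonneg[OF f] by (simp add: c_def)
  have "\<exists>\<delta>>0. \<forall>x\<in>{0..1}. \<forall>y\<in>{0..1}. x \<noteq> y \<and> \<bar>x - y\<bar> < \<delta> \<longrightarrow> holder_quot \<alpha> (smooth n f) x y < \<epsilon>"
    if \<epsilon>: "\<epsilon> > 0" for \<epsilon>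
  proof -
    obtain \<delta> where \<delta>: "\<delta> > 0" "\<forall>d. 0 \<le> d \<longrightarrow> d < \<delta> \<longrightarrow> c * d powr (1 - \<alpha>) < \<epsilon>"
      using small_powr[OF c _ \<epsilon>, of "1 - \<alpha>"] \<alpha> by auto
    have "holder_quot \<alpha> (smooth n f) x y < \<epsilon>"
      if xy: "x \<in> {0..1}" "y \<in> {0..1}" "x \<noteq> y" "\<bar>x - y\<bar> < \<delta>" for x y
    proof -
      have "holder_quot \<alpha> (smooth n f) x y \<le> c * \<bar>x - y\<bar> powr (1 - \<alpha>)"
        using smooth_lipschitz[OF f xy(1,2)] xy(3)
        by (simp add: holder_quot_le_iff c_def mult.assoc flip: powr_add)
      also have "\<dots> < \<epsilon>" using \<delta>(2) xy(4) by simp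
      finally show ?thesis .
    qed
    then show ?thesis using \<delta>(1) by blast
  qed
  then show ?thesis using smooth_holder[OF f] by (simp add: little_holder_space_def)
qed

end

lemma dyadic_powr_tendsto_0: "(\<lambda>n. c * ((1/2) ^ n) powr \<alpha> :: real) \<longlonglongrightarrow> 0"
proof -
  have "(\<lambda>n. ((1/2) ^ n) powr \<alpha>) \<longlonglongrightarrow> (0::real) powr \<alpha>"
    using \<alpha> by (intro tendsto_powr2 LIMSEQ_realpow_zero tendsto_const) auto
  from tendsto_mult[OF tendsto_const[of c] this] show ?thesis by simp
qed

lemma smooth_tendsto:
  fixes f :: "real \<Rightarrow> 'k::{real_normed_field,banach}"
  assumes "f \<in> holder_space \<alpha>" "x \<in> {0..1}"
  shows "(\<lambda>n. smooth n f x) \<longlonglongrightarrow> f x"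
proof -
  have "(\<lambda>n. smooth n f x - f x) \<longlonglongrightarrow> 0"
    by (intro Lim_null_comparison[OF always_eventually dyadic_powr_tendsto_0[of "2 * Lip f"]]
        allI smooth_close[OF assms])
  then show ?thesis by (simp add: LIM_zero_iff)
qed

text \<open>
  At distances below \<open>\<delta>\<close> both \<open>u\<close> and its smoothing have small difference quotients. At larger distances
  uniform convergence suffices, since the denominators are at least \<open>\<delta> powr \<alpha>\<close>.
\<close>

lemma smooth_approx:
  fixes u :: "real \<Rightarrow> 'k::{real_normed_field,banach}"
  assumes u: "u \<in> little_holder_space \<alpha>"
  shows "(\<lambda>n. Lip (u - smooth n u)) \<longlonglongrightarrow> 0"
proof (rule LIMSEQ_I)
  fix e :: real assume e: "e > 0"
  have uH: "u \<in> holder_space \<alpha>" using u little_subset_holder by blast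
  obtain \<delta> where \<delta>: "\<delta> > 0"
    "\<And>x y. \<lbrakk>x \<in> {0..1}; y \<in> {0..1}; x \<noteq> y; \<bar>x - y\<bar> < \<delta>\<rbrakk> \<Longrightarrow> holder_quot \<alpha> u x y < e / 4"
    using little_holderE[OF u, of "e / 4"] e by auto
  have dp: "e / 2 * \<delta> powr \<alpha> > 0" using e \<delta>(1) by simp
  obtain M where M: "\<And>n. n \<ge> M \<Longrightarrow> 4 * Lip u * ((1/2) ^ n) powr \<alpha> < e / 2 * \<delta> powr \<alpha>"
    using LIMSEQ_D[OF dyadic_powr_tendsto_0[of "4 * Lip u"] dp] by fastforce
  have "norm (Lip (u - smooth n u) - 0) < e" if n: "n \<ge> M" for n
  proof -
    have "norm ((u - smooth n u) x - (u - smooth n u) y) \<le> e / 2 * \<bar>x - y\<bar> powr \<alpha>"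
      if xy: "x \<in> {0..1}" "y \<in> {0..1}" "x \<noteq> y" for x y
    proof (cases "\<bar>x - y\<bar> < \<delta>")
      case True
      have small: "norm (u a - u b) \<le> e / 4 * \<bar>a - b\<bar> powr \<alpha>"
        if "a \<in> {0..1}" "b \<in> {0..1}" "\<bar>a - b\<bar> \<le> \<bar>x - y\<bar>" for a b
      proof (cases "a = b")
        case False
        have "holder_quot \<alpha> u a b < e / 4" using \<delta>(2)[of a b] that True False by simp
        then show ?thesis by (simp only: holder_quot_less_iff[OF False] less_imp_le)
      qed simp
      have "norm (smooth n u x - smooth n u y) \<le> e / 4 * \<bar>x - y\<bar> powr \<alpha>"
        using e by (intro norm_smooth_diff_le uH xy small) auto
      moreover have "norm (u x - u y) \<le> e / 4 * \<bar>x - y\<bar> powr \<alpha>" by (intro small xy) simp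
      ultimately show ?thesis
        using norm_triangle_ineq4[of "u x - u y" "smooth n u x - smooth n u y"]
        by (simp add: algebra_simps)
    next
      case False
      have "norm ((u - smooth n u) x - (u - smooth n u) y) \<le>
          norm (smooth n u x - u x) + norm (smooth n u y - u y)"
        using norm_triangle_ineq4[of "smooth n u x - u x" "smooth n u y - u y"]
        by (simp add: algebra_simps norm_minus_commute)
      also have "\<dots> \<le> e / 2 * \<delta> powr \<alpha>"
        using smooth_close[OF uH xy(1), of n] smooth_close[OF uH xy(2), of n] M[OF n] by simp
      also have "\<dots> \<le> e / 2 * \<bar>x - y\<bar> powr \<alpha>"
        using False e \<delta>(1) \<alpha> by (intro mult_left_mono powr_mono2) auto
      finally show ?thesis .
    qed
    then have "Lip (u - smooth n u) \<le> e / 2"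
      by (intro holder_spaceI) (auto simp: smooth_outside smooth_0 holder_spaceD[OF uH])
    moreover have "0 \<le> Lip (u - smooth n u)"
      using uH smooth_holder[OF uH] by (intro holder_norm_nonneg) simp
    ultimately show ?thesis using e by simp
  qed
  then show "\<exists>M. \<forall>n\<ge>M. norm (Lip (u - smooth n u) - 0) < e" by blast
qed

text \<open>
  At distances below \<open>\<delta>\<close> the quotients of \<open>u\<close> are at most \<open>\<epsilon>\<close> and those of the difference at most 1; at
  larger distances those of \<open>u\<close> are at most 1 and those of the difference are small by uniform
  convergence.
\<close>

lemma smooth_tail:
  fixes u f :: "real \<Rightarrow> 'k::{real_normed_field,banach}"
  assumes u: "u \<in> little_holder_space \<alpha>" "Lip u \<le> 1"
    and f: "f \<in> holder_space \<alpha>" "Lip f \<le> 1/2" and \<epsilon>: "\<epsilon> > 0"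
  shows "\<exists>M. \<forall>m\<ge>M. \<forall>n\<ge>M. \<forall>c. norm c = 1 \<longrightarrow>
    Lip (u + fun_scale c (smooth m f - smooth n f)) \<le> 1 + \<epsilon>"
proof -
  have uH: "u \<in> holder_space \<alpha>" using u little_subset_holder by blast
  obtain \<delta> where \<delta>: "\<delta> > 0"
    "\<And>x y. \<lbrakk>x \<in> {0..1}; y \<in> {0..1}; x \<noteq> y; \<bar>x - y\<bar> < \<delta>\<rbrakk> \<Longrightarrow> holder_quot \<alpha> u x y < \<epsilon>"
    using little_holderE[OF u(1) \<epsilon>] by metis
  have dp: "\<epsilon> * \<delta> powr \<alpha> > 0" using \<epsilon> \<delta>(1) by simp
  obtain M where M: "\<And>n. n \<ge> M \<Longrightarrow> 4 * ((1/2) ^ n) powr \<alpha> < \<epsilon> * \<delta> powr \<alpha>"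
    using LIMSEQ_D[OF dyadic_powr_tendsto_0[of 4] dp] by fastforce
  have "Lip (u + fun_scale c (smooth m f - smooth n f)) \<le> 1 + \<epsilon>"
    if mn: "m \<ge> M" "n \<ge> M" and c: "norm c = 1" for m n c
  proof (rule holder_spaceI)
    define w where "w = smooth m f - smooth n f"
    fix x y :: real assume xy: "x \<in> {0..1}" "y \<in> {0..1}" "x \<noteq> y"
    have "norm ((u + fun_scale c w) x - (u + fun_scale c w) y)
        \<le> norm (u x - u y) + norm (c * (w x - w y))"
      using norm_triangle_ineq[of "u x - u y" "c * (w x - w y)"]
      by (simp add: fun_scale_def algebra_simps)
    then have split: "norm ((u + fun_scale c w) x - (u + fun_scale c w) y) \<le> norm (u x - u y) + norm (w x - w y)"
      using c by (simp add: norm_mult)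
    show "norm ((u + fun_scale c (smooth m f - smooth n f)) x - (u + fun_scale c (smooth m f - smooth n f)) y)
        \<le> (1 + \<epsilon>) * \<bar>x - y\<bar> powr \<alpha>"
    proof (cases "\<bar>x - y\<bar> < \<delta>")
      case True
      have bnd: "norm (smooth k f x - smooth k f y) \<le> 1/2 * \<bar>x - y\<bar> powr \<alpha>" for k
      proof -
        have "norm (smooth k f x - smooth k f y) \<le> Lip (smooth k f) * \<bar>x - y\<bar> powr \<alpha>"
          by (intro holder_bound smooth_holder f xy)
        also have "\<dots> \<le> 1/2 * \<bar>x - y\<bar> powr \<alpha>"
          using order_trans[OF smooth_holder(2)[OF f(1)] f(2)] by (intro mult_right_mono) auto
        finally show ?thesis .
      qed
      have "norm (w x - w y) \<le> \<bar>x - y\<bar> powr \<alpha>"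
        using norm_triangle_ineq4[of "smooth m f x - smooth m f y" "smooth n f x - smooth n f y"]
          bnd[of m] bnd[of n] by (simp add: w_def algebra_simps)
      moreover have "norm (u x - u y) < \<epsilon> * \<bar>x - y\<bar> powr \<alpha>"
        using \<delta>(2)[OF xy True] xy(3) by (simp add: holder_quot_less_iff)
      ultimately show ?thesis using split by (simp add: w_def algebra_simps)
    next
      case False
      have close: "norm (w z) \<le> \<epsilon> / 2 * \<delta> powr \<alpha>" if z: "z \<in> {0..1}" for z
      proof -
        have close_f: "norm (smooth k f z - f z) \<le> \<epsilon> / 4 * \<delta> powr \<alpha>" if k: "k \<ge> M" for k
        proof -
          have "norm (smooth k f z - f z) \<le> 2 * Lip f * ((1/2) ^ k) powr \<alpha>"
            by (rule smooth_close[OF f(1) z])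
          also have "\<dots> \<le> 1 * ((1/2) ^ k) powr \<alpha>"
            using f(2) by (intro mult_right_mono) auto
          also have "\<dots> \<le> \<epsilon> / 4 * \<delta> powr \<alpha>" using M[OF k] by simp
          finally show ?thesis .
        qed
        show ?thesis
          using norm_triangle_ineq4[of "smooth m f z - f z" "smooth n f z - f z"]
            close_f[OF mn(1)] close_f[OF mn(2)] by (simp add: w_def algebra_simps)
      qed
      have "norm (w x - w y) \<le> \<epsilon> * \<delta> powr \<alpha>"
        using norm_triangle_ineq4[of "w x" "w y"] close[OF xy(1)] close[OF xy(2)] by simp
      also have "\<dots> \<le> \<epsilon> * \<bar>x - y\<bar> powr \<alpha>"
        using False \<epsilon> \<delta>(1) \<alpha> by (intro mult_left_mono powr_mono2) auto
      finally have "norm (w x - w y) \<le> \<epsilon> * \<bar>x - y\<bar> powr \<alpha>" .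
      moreover have "norm (u x - u y) \<le> 1 * \<bar>x - y\<bar> powr \<alpha>"
        using holder_bound[OF uH xy(1,2)] mult_right_mono[OF u(2), of "\<bar>x - y\<bar> powr \<alpha>"] by simp
      ultimately show ?thesis using split by (simp add: w_def algebra_simps)
    qed
  qed (auto simp: fun_scale_def smooth_outside smooth_0 holder_spaceD[OF uH])
  then show ?thesis by blast
qed

text \<open>
  The two geometric series that bound the total error over all coarse and all fine scales.
\<close>

definition mix_const :: real where
  "mix_const = 2 / (1 - 2 powr (\<alpha> - 1)) + 8 / (1 - 2 powr (- \<alpha>))"

lemma ratios: "2 powr (\<alpha> - 1) < (1::real)" "2 powr (- \<alpha>) < (1::real)"
  using \<alpha> powr_less_mono[of "\<alpha> - 1" 0 "2::real"] powr_less_mono[of "- \<alpha>" 0 "2::real"] by auto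

text \<open>
  For windows at least as long as \<open>\<bar>x - y\<bar>\<close> the increments of \<open>smooth n f\<close> and \<open>smooth n g\<close> are controlled by
  their Lipschitz constants, and the increment of \<open>g\<close> remains.
\<close>

lemma mix_term_coarse:
  fixes f g :: "real \<Rightarrow> 'k::{real_normed_field,banach}"
  assumes fg: "f \<in> holder_space \<alpha>" "g \<in> holder_space \<alpha>" "Lip f \<le> 1" "Lip g \<le> 1"
    and xy: "x \<in> {0..1}" "y \<in> {0..1}" and d: "0 < \<bar>x - y\<bar>" "\<bar>x - y\<bar> \<le> (1/2) ^ m" and n: "n \<le> m"
  shows "norm ((smooth n f x + (g x - smooth n g x)) - (smooth n f y + (g y - smooth n g y)))
    \<le> (1 + 2 * (2 powr (\<alpha> - 1)) ^ (m - n)) * \<bar>x - y\<bar> powr \<alpha>"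
proof -
  let ?d = "\<bar>x - y\<bar>" and ?h = "(1/2::real) ^ n"
  have lip: "norm (smooth n k x - smooth n k y) \<le> (2 powr (\<alpha> - 1)) ^ (m - n) * ?d powr \<alpha>"
    if k: "k \<in> holder_space \<alpha>" "Lip k \<le> 1" for k :: "real \<Rightarrow> 'k"
  proof -
    have "2 ^ (m - n) * ?d \<le> 2 ^ (m - n) * (1/2) ^ m" using d by (intro mult_left_mono) auto
    also have "\<dots> = ?h" using n by (simp add: power_diff power_one_over)
    finally have le: "2 ^ (m - n) * ?d \<le> ?h" .
    have "norm (smooth n k x - smooth n k y) \<le> Lip k * ?h powr (\<alpha> - 1) * ?d"
      by (rule smooth_lipschitz[OF k(1) xy])
    also have "\<dots> \<le> 1 * (2 ^ (m - n) * ?d) powr (\<alpha> - 1) * ?d"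
      using k d le \<alpha> holder_norm_nonneg[OF k(1)] by (intro mult_mono powr_mono2') auto
    also have "\<dots> = (2 powr (\<alpha> - 1)) ^ (m - n) * (?d powr (\<alpha> - 1) * ?d)"
      by (simp add: powr_mult powr_powr powr_realpow[symmetric] mult.commute)
    also have "?d powr (\<alpha> - 1) * ?d = ?d powr \<alpha>" using d by (simp add: powr_diff)
    finally show ?thesis .
  qed
  have "norm (g x - g y) \<le> 1 * ?d powr \<alpha>"
    using holder_bound[OF fg(2) xy] mult_right_mono[OF fg(4), of "?d powr \<alpha>"] by simp
  moreover have "norm ((smooth n f x + (g x - smooth n g x)) - (smooth n f y + (g y - smooth n g y)))
      \<le> norm (g x - g y) + norm (smooth n f x - smooth n f y) + norm (smooth n g x - smooth n g y)"
    using norm_triangle_ineq4[of "(g x - g y) + (smooth n f x - smooth n f y)" "smooth n g x - smooth n g y"]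
      norm_triangle_ineq[of "g x - g y" "smooth n f x - smooth n f y"]
    by (simp add: algebra_simps)
  ultimately show ?thesis
    using lip[OF fg(1,3)] lip[OF fg(2,4)] by (simp add: algebra_simps)
qed

text \<open>
  For windows shorter than \<open>\<bar>x - y\<bar>\<close> the smoothings are uniformly close to \<open>f\<close> and \<open>g\<close>, so that \<open>g\<close>
  nearly cancels and the increment of \<open>f\<close> remains.
\<close>

lemma mix_term_fine:
  fixes f g :: "real \<Rightarrow> 'k::{real_normed_field,banach}"
  assumes fg: "f \<in> holder_space \<alpha>" "g \<in> holder_space \<alpha>" "Lip f \<le> 1" "Lip g \<le> 1"
    and xy: "x \<in> {0..1}" "y \<in> {0..1}" and d: "(1/2) ^ Suc m < \<bar>x - y\<bar>" and n: "m < n"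
  shows "norm ((smooth n f x + (g x - smooth n g x)) - (smooth n f y + (g y - smooth n g y)))
    \<le> (1 + 8 * (2 powr (- \<alpha>)) ^ (n - Suc m)) * \<bar>x - y\<bar> powr \<alpha>"
proof -
  let ?d = "\<bar>x - y\<bar>" and ?h = "(1/2::real) ^ n" and ?q = "(2 powr (- \<alpha>)) ^ (n - Suc m)"
  have "?h = (1/2) ^ (n - Suc m) * (1/2) ^ Suc m" using n by (simp flip: power_add del: power_Suc)
  also have "\<dots> \<le> (1/2) ^ (n - Suc m) * ?d" using d by (intro mult_left_mono) auto
  finally have "?h powr \<alpha> \<le> ((1/2) ^ (n - Suc m) * ?d) powr \<alpha>"
    using \<alpha> by (intro powr_mono2) auto
  also have "\<dots> = ?q * ?d powr \<alpha>"
    by (simp add: powr_mult powr_powr powr_realpow[symmetric] powr_minus_divide powr_divide mult.commute power_one_over)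
  finally have h: "?h powr \<alpha> \<le> ?q * ?d powr \<alpha>" .
  have close: "norm (smooth n k z - k z) \<le> 2 * (?q * ?d powr \<alpha>)"
    if k: "k \<in> holder_space \<alpha>" "Lip k \<le> 1" and z: "z \<in> {0..1}" for k :: "real \<Rightarrow> 'k" and z
  proof -
    have "norm (smooth n k z - k z) \<le> 2 * Lip k * ?h powr \<alpha>" by (rule smooth_close[OF k(1) z])
    also have "\<dots> \<le> 2 * (?q * ?d powr \<alpha>)"
      using k h mult_mono[of "2 * Lip k" 2 "?h powr \<alpha>" "?q * ?d powr \<alpha>"] by simp
    finally show ?thesis .
  qed
  have "norm (f x - f y) \<le> 1 * ?d powr \<alpha>"
    using holder_bound[OF fg(1) xy] mult_right_mono[OF fg(3), of "?d powr \<alpha>"] by simp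
  moreover have "norm ((smooth n f x + (g x - smooth n g x)) - (smooth n f y + (g y - smooth n g y)))
      \<le> norm (f x - f y) + (norm (smooth n f x - f x) + norm (smooth n f y - f y)) +
        (norm (smooth n g x - g x) + norm (smooth n g y - g y))"
  proof -
    have eq: "(smooth n f x + (g x - smooth n g x)) - (smooth n f y + (g y - smooth n g y)) =
        ((f x - f y) + ((smooth n f x - f x) - (smooth n f y - f y))) -
        ((smooth n g x - g x) - (smooth n g y - g y))"
      by (simp add: algebra_simps)
    show ?thesis
      unfolding eq
      by (intro order_trans[OF norm_triangle_ineq4] add_mono order_trans[OF norm_triangle_ineq]
          norm_triangle_ineq4 order_refl)
  qed
  ultimately show ?thesis
    using close[OF fg(1,3) xy(1)] close[OF fg(1,3) xy(2)] close[OF fg(2,4) xy(1)] close[OF fg(2,4) xy(2)]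
    by (simp add: algebra_simps)
qed

text \<open>
  With \<open>m\<close> the dyadic scale of the distance of two points, the errors of the terms \<open>n\<close> decay
  geometrically in the distance of \<open>n\<close> from \<open>m\<close>. Hence the sum of \<open>K\<close> terms has norm at most
  \<open>K + mix_const\<close>, uniformly in the position of \<open>m\<close>, and \<open>K\<close> can be taken large.
\<close>

lemma smooth_mix:
  fixes f g :: "real \<Rightarrow> 'k::{real_normed_field,banach}"
  assumes fg: "f \<in> holder_space \<alpha>" "g \<in> holder_space \<alpha>" "Lip f \<le> 1" "Lip g \<le> 1" and \<epsilon>: "\<epsilon> > 0"
  shows "\<exists>K>0. Lip (\<Sum>n=M..<M+K. smooth n f + (g - smooth n g)) \<le> (1 + \<epsilon>) * real K"
proof -
  define p q where "p = 2 powr (\<alpha> - 1)" and "q = 2 powr (- \<alpha>)"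
  have pq: "0 \<le> p" "p < 1" "0 \<le> q" "q < 1" using ratios by (simp_all add: p_def q_def)
  obtain K where K: "K > 0" "mix_const \<le> \<epsilon> * real K"
  proof -
    obtain k where "mix_const / \<epsilon> \<le> real k" using real_arch_simple by blast
    then have "mix_const / \<epsilon> \<le> real (Suc k)" by simp
    then show ?thesis using that[of "Suc k"] \<epsilon> by (simp add: pos_divide_le_eq mult.commute)
  qed
  define y where "y n = smooth n f + (g - smooth n g)" for n
  have "Lip (\<Sum>n=M..<M+K. y n) \<le> real K + mix_const"
  proof (rule holder_spaceI)
    have sum_app: "(\<Sum>n\<in>A. y n) x = (\<Sum>n\<in>A. y n x)" for A x
      by (induction A rule: infinite_finite_induct) auto
    show "(\<Sum>n=M..<M+K. y n) x = 0" if "x \<notin> {0..1}" for x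
      using that by (simp add: sum_app) (simp add: y_def smooth_outside holder_spaceD[OF fg(2)])
    show "(\<Sum>n=M..<M+K. y n) 0 = 0"
      by (simp add: sum_app) (simp add: y_def smooth_0 holder_spaceD[OF fg(2)])
    fix a b :: real assume ab: "a \<in> {0..1}" "b \<in> {0..1}" "a \<noteq> b"
    have d: "0 < \<bar>a - b\<bar>" "\<bar>a - b\<bar> \<le> 1" using ab by auto
    obtain m where m: "(1/2) ^ Suc m < \<bar>a - b\<bar>" "\<bar>a - b\<bar> \<le> (1/2) ^ m"
      using dyadic_scale[OF d] by blast
    \<comment> \<open>the relative error of the term \<open>n\<close> at the distance \<open>\<bar>a - b\<bar>\<close>\<close>
    define e where "e n = (if n \<le> m then 2 * p ^ (m - n) else 8 * q ^ (n - Suc m))" for n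
    have bnd: "norm (y n a - y n b) \<le> (1 + e n) * \<bar>a - b\<bar> powr \<alpha>" for n
      using mix_term_coarse[OF fg ab(1,2) d(1) m(2), of n] mix_term_fine[OF fg ab(1,2) m(1), of n]
      by (simp add: e_def y_def p_def q_def)
    let ?I = "{M..<M+K}"
    have "(\<Sum>n\<in>?I. e n) = 2 * (\<Sum>n\<in>?I \<inter> {n. n \<le> m}. p ^ (m - n)) + 8 * (\<Sum>n\<in>?I \<inter> - {n. n \<le> m}. q ^ (n - Suc m))"
      unfolding e_def by (simp add: sum.If_cases sum_distrib_left)
    also have "\<dots> \<le> 2 * (1 / (1 - p)) + 8 * (1 / (1 - q))"
      using pq by (intro add_mono mult_left_mono sum_geometric_inj_le) (auto simp: inj_on_def)
    also have "\<dots> = mix_const" by (simp add: mix_const_def p_def q_def)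
    finally have e: "(\<Sum>n\<in>?I. e n) \<le> mix_const" .
    have "norm ((\<Sum>n\<in>?I. y n) a - (\<Sum>n\<in>?I. y n) b) = norm (\<Sum>n\<in>?I. y n a - y n b)"
      by (simp add: sum_app sum_subtractf)
    also have "\<dots> \<le> (\<Sum>n\<in>?I. (1 + e n) * \<bar>a - b\<bar> powr \<alpha>)" by (intro sum_norm_le bnd)
    also have "\<dots> = (real K + (\<Sum>n\<in>?I. e n)) * \<bar>a - b\<bar> powr \<alpha>"
      by (simp add: sum.distrib flip: sum_distrib_right)
    also have "\<dots> \<le> (real K + mix_const) * \<bar>a - b\<bar> powr \<alpha>"
      using e by (intro mult_right_mono) auto
    finally show "norm ((\<Sum>n\<in>?I. y n) a - (\<Sum>n\<in>?I. y n) b) \<le> (real K + mix_const) * \<bar>a - b\<bar> powr \<alpha>" .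
  qed
  also have "\<dots> \<le> (1 + \<epsilon>) * real K" using K by (simp add: algebra_simps)
  finally show ?thesis using K unfolding y_def by blast
qed

lemma little_M_ideal:
  "M_ideal fun_scale (omega_holder_space \<alpha>) Lip
     (little_holder_space \<alpha> :: (real \<Rightarrow> 'k::{real_normed_field,banach}) set)"
proof -
  have sub: "f \<in> holder_space \<alpha>" if "f \<in> omega_holder_space \<alpha>" for f :: "real \<Rightarrow> 'k"
    using that omega_subset_holder by blast
  interpret W: banach_space_on fun_scale "omega_holder_space \<alpha> :: (real \<Rightarrow> 'k) set" Lip
    by (rule omega_banach)
  interpret smoothing_operators fun_scale "omega_holder_space \<alpha> :: (real \<Rightarrow> 'k) set" Lip
    "little_holder_space \<alpha>" smooth
  proof
    fix f g :: "real \<Rightarrow> 'k" and n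
    assume f: "f \<in> omega_holder_space \<alpha>"
    show "smooth n f \<in> little_holder_space \<alpha>" by (rule smooth_little[OF sub[OF f]])
    show "smooth n (fun_scale c f) = fun_scale c (smooth n f)" for c
      by (rule smooth_scale[OF sub[OF f]])
    show "Lip (smooth n f) \<le> Lip f" by (rule smooth_holder[OF sub[OF f]])
    assume g: "g \<in> omega_holder_space \<alpha>"
    show "smooth n (f + g) = smooth n f + smooth n g" by (rule smooth_add[OF sub[OF f] sub[OF g]])
    show "\<exists>K>0. Lip (\<Sum>n=M..<M+K. smooth n f + (g - smooth n g)) \<le> (1 + \<epsilon>) * real K"
      if "Lip f \<le> 1" "Lip g \<le> 1" "0 < \<epsilon>" for \<epsilon> M
      by (rule smooth_mix[OF sub[OF f] sub[OF g] that])
  next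
    fix u f :: "real \<Rightarrow> 'k" and \<epsilon> :: real
    assume u: "u \<in> little_holder_space \<alpha>"
    show "(\<lambda>n. Lip (u - smooth n u)) \<longlonglongrightarrow> 0" by (rule smooth_approx[OF u])
    assume "Lip u \<le> 1" "f \<in> omega_holder_space \<alpha>" "Lip f \<le> 1/2" "0 < \<epsilon>"
    then show "\<exists>M. \<forall>m\<ge>M. \<forall>n\<ge>M. \<forall>c. norm c = 1 \<longrightarrow>
        Lip (u + fun_scale c (smooth m f - smooth n f)) \<le> 1 + \<epsilon>"
      by (intro smooth_tail u sub)
  qed (rule little_closed_subspace)
  show ?thesis by (rule M_ideal_U)
qed

text \<open>
  The function \<open>t \<mapsto> t\<^sup>\<alpha>\<close> is smooth away from 0, but its difference quotients between 0 and any
  other point equal 1. So 0 is the one exceptional point that the larger space tolerates and the little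
  Hoelder space does not.
\<close>

definition power_fun :: "real \<Rightarrow> 'k::real_normed_field" where
  "power_fun t = (if t \<in> {0..1} then of_real (t powr \<alpha>) else 0)"

lemma norm_power_fun_diff:
  assumes "x \<in> {0..1}" "y \<in> {0..1}"
  shows "norm (power_fun x - power_fun y :: 'k::real_normed_field) = \<bar>x powr \<alpha> - y powr \<alpha>\<bar>"
  using assms by (simp add: power_fun_def flip: of_real_diff)

lemma power_fun_holder: "power_fun \<in> holder_space \<alpha>" "Lip (power_fun :: real \<Rightarrow> 'k::real_normed_field) \<le> 1"
proof -
  have *: "norm (power_fun x - power_fun y :: 'b::real_normed_field) \<le> 1 * \<bar>x - y\<bar> powr \<alpha>"
    if "x \<in> {0..1}" "y \<in> {0..1}" for x y
    using powr_diff_le[of x y \<alpha>] \<alpha> that by (simp add: norm_power_fun_diff)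
  show "power_fun \<in> holder_space \<alpha>"
    by (rule holder_spaceI(1)[OF _ _ *]) (auto simp: power_fun_def)
  show "Lip (power_fun :: real \<Rightarrow> 'k) \<le> 1"
    by (rule holder_spaceI(2)[OF _ _ *]) (auto simp: power_fun_def)
qed

lemma power_fun_local_lipschitz:
  assumes "0 < r" "r \<le> x" "r \<le> y"
  shows "\<bar>x powr \<alpha> - y powr \<alpha>\<bar> \<le> r powr (\<alpha> - 1) * \<bar>x - y\<bar>"
proof -
  have "norm (x powr \<alpha> - y powr \<alpha>) \<le> r powr (\<alpha> - 1) * norm (x - y)"
  proof (rule field_differentiable_bound[of "{r..}"])
    fix z assume z: "z \<in> {r..}"
    then show "((\<lambda>z. z powr \<alpha>) has_field_derivative \<alpha> * z powr (\<alpha> - 1)) (at z within {r..})"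
      using assms by (intro has_real_derivative_powr[THEN has_field_derivative_at_within]) auto
    have "\<alpha> * z powr (\<alpha> - 1) \<le> 1 * r powr (\<alpha> - 1)"
      using z assms \<alpha> by (intro mult_mono powr_mono2') auto
    then show "norm (\<alpha> * z powr (\<alpha> - 1)) \<le> r powr (\<alpha> - 1)" using \<alpha> by simp
  qed (use assms in auto)
  then show ?thesis by simp
qed

lemma power_fun_omega: "(power_fun :: real \<Rightarrow> 'k::real_normed_field) \<in> omega_holder_space \<alpha>"
proof -
  have "oscillation_le_off {0} (power_fun :: real \<Rightarrow> 'k) \<epsilon>" if \<epsilon>: "\<epsilon> > 0" for \<epsilon>
    unfolding oscillation_le_off_def
  proof
    fix t :: real assume t: "t \<in> {0..1} - {0}"
    \<comment> \<open>near \<open>t\<close> the function is Lipschitz, which gives small Hoelder quotients at small distances\<close>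
    define r where "r = t / 2"
    have r: "0 < r" using t by (auto simp: r_def)
    obtain \<delta> where \<delta>: "\<delta> > 0" "\<forall>d. 0 \<le> d \<longrightarrow> d < \<delta> \<longrightarrow> r powr (\<alpha> - 1) * d powr (1 - \<alpha>) < \<epsilon>"
      using small_powr[of "r powr (\<alpha> - 1)" "1 - \<alpha>" \<epsilon>] \<alpha> \<epsilon> by auto
    define U where "U = {0..1} \<inter> ball t (min r (\<delta> / 2))"
    have "holder_quot \<alpha> (power_fun :: real \<Rightarrow> 'k) x y \<le> \<epsilon>" if xy: "x \<in> U" "y \<in> U" "x \<noteq> y" for x y
    proof -
      have near: "\<bar>t - x\<bar> < r" "\<bar>t - y\<bar> < r" "\<bar>t - x\<bar> < \<delta> / 2" "\<bar>t - y\<bar> < \<delta> / 2" and I: "x \<in> {0..1}" "y \<in> {0..1}"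
        using xy by (auto simp: U_def dist_real_def)
      have lower: "r \<le> x" "r \<le> y" using near unfolding r_def by linarith+
      have d: "\<bar>x - y\<bar> < \<delta>" using near by linarith
      have "norm (power_fun x - power_fun y :: 'k) \<le> r powr (\<alpha> - 1) * \<bar>x - y\<bar>"
        using power_fun_local_lipschitz[OF r lower] I by (simp add: norm_power_fun_diff)
      also have "\<dots> = r powr (\<alpha> - 1) * \<bar>x - y\<bar> powr (1 - \<alpha>) * \<bar>x - y\<bar> powr \<alpha>"
        using xy by (simp add: mult.assoc flip: powr_add)
      also have "\<dots> \<le> \<epsilon> * \<bar>x - y\<bar> powr \<alpha>"
        using \<delta>(2) d by (intro mult_right_mono) (auto intro: less_imp_le)
      finally show ?thesis using xy(3) by (simp add: holder_quot_le_iff)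
    qed
    moreover have "openin (top_of_set {0..1}) U" unfolding U_def by (intro openin_open_Int open_ball)
    moreover have "t \<in> U" using t r \<delta>(1) by (simp add: U_def)
    ultimately show "\<exists>U. openin (top_of_set {0..1}) U \<and> t \<in> U \<and>
        (\<forall>x\<in>U. \<forall>y\<in>U. x \<noteq> y \<longrightarrow> holder_quot \<alpha> (power_fun :: real \<Rightarrow> 'k) x y \<le> \<epsilon>)" by meson
  qed
  then show ?thesis
    using power_fun_holder(1) by (auto simp: omega_holder_space_iff intro!: exI[of _ "{0}"])
qed

lemma power_fun_not_little: "(power_fun :: real \<Rightarrow> 'k::real_normed_field) \<notin> little_holder_space \<alpha>"
proof
  assume "(power_fun :: real \<Rightarrow> 'k) \<in> little_holder_space \<alpha>"
  then obtain \<delta> where \<delta>: "\<delta> > 0"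
    "\<And>x y. \<lbrakk>x \<in> {0..1}; y \<in> {0..1}; x \<noteq> y; \<bar>x - y\<bar> < \<delta>\<rbrakk> \<Longrightarrow> holder_quot \<alpha> (power_fun :: real \<Rightarrow> 'k) x y < 1"
    using little_holderE[of "power_fun :: real \<Rightarrow> 'k" 1] by auto
  define x where "x = min 1 (\<delta> / 2)"
  have x: "0 < x" "x \<le> 1" "x < \<delta>" using \<delta>(1) by (auto simp: x_def)
  have "norm (power_fun x - power_fun 0 :: 'k) = x powr \<alpha>"
    using x norm_power_fun_diff[of x 0] by simp
  moreover have "norm (power_fun x - power_fun 0 :: 'k) < 1 * \<bar>x - 0\<bar> powr \<alpha>"
    using \<delta>(2)[of x 0] x by (simp add: holder_quot_less_iff)
  ultimately show False using x by simp
qed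

text \<open>
  Test a vector \<open>v\<close> of the complement against multiples \<open>z * smooth n power_fun\<close> with \<open>\<bar>z\<bar>\<close> equal to the
  norm of \<open>v\<close>. Between 0 and a point \<open>y\<close> where \<open>v\<close> does not vanish, their increments tend to
  \<open>z * y powr \<alpha>\<close>, which has the largest possible absolute value and the same phase as \<open>v y\<close>.
\<close>

lemma little_not_M_summand:
  "\<not> M_summand fun_scale (omega_holder_space \<alpha>) Lip
     (little_holder_space \<alpha> :: (real \<Rightarrow> 'k::{real_normed_field,banach}) set)"
proof
  interpret W: normed_space_on fun_scale "omega_holder_space \<alpha> :: (real \<Rightarrow> 'k) set" Lip
    by (rule omega_normed_space)
  assume M: "M_summand fun_scale (omega_holder_space \<alpha>) Lip (little_holder_space \<alpha> :: (real \<Rightarrow> 'k) set)"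
  have ne: "little_holder_space \<alpha> \<noteq> (omega_holder_space \<alpha> :: (real \<Rightarrow> 'k) set)"
    using power_fun_omega power_fun_not_little by blast
  obtain v :: "real \<Rightarrow> 'k" where v: "v \<in> omega_holder_space \<alpha>" "v \<noteq> 0"
    and max: "\<And>u. u \<in> little_holder_space \<alpha> \<Longrightarrow> Lip (u + v) \<le> max (Lip u) (Lip v)"
    using W.M_summand_complement[OF M ne] by blast
  have vH: "v \<in> holder_space \<alpha>" using v omega_subset_holder by blast
  obtain y where vy: "v y \<noteq> 0" using v(2) by (auto simp: fun_eq_iff)
  then have y: "y \<in> {0..1}" "y \<noteq> 0" using holder_spaceD[OF vH] by auto
  define l where "l = Lip v"
  have l: "l > 0" using norm_le_holder_norm[OF vH, of y] vy unfolding l_def by (smt (verit) zero_less_norm_iff)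
  \<comment> \<open>\<open>z\<close> has absolute value \<open>l\<close> and the phase of \<open>v y\<close>\<close>
  define z where "z = of_real (l / norm (v y)) * v y"
  have nz: "norm z = l" using l vy by (simp add: z_def norm_mult norm_divide)
  have "norm (z * smooth n power_fun y + v y) \<le> l * y powr \<alpha>" for n
  proof -
    define u where "u = fun_scale z (smooth n (power_fun :: real \<Rightarrow> 'k))"
    have uL: "u \<in> little_holder_space \<alpha>"
      unfolding u_def by (intro H.subspace_scale[OF little_subspace] smooth_little power_fun_holder)
    have "Lip u \<le> norm z * Lip (smooth n (power_fun :: real \<Rightarrow> 'k))"
      unfolding u_def by (intro holder_scale smooth_holder power_fun_holder)
    also have "\<dots> \<le> l * 1"
      using order_trans[OF smooth_holder(2)[OF power_fun_holder(1)] power_fun_holder(2)] nz l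
      by (intro mult_mono) (auto intro!: holder_norm_nonneg smooth_holder power_fun_holder)
    finally have uv: "Lip (u + v) \<le> l" using max[OF uL] by (simp add: l_def)
    have uvH: "u + v \<in> holder_space \<alpha>" using uL little_subset_holder vH by (intro holder_add) auto
    have "norm ((u + v) y) \<le> Lip (u + v) * \<bar>y\<bar> powr \<alpha>"
      using holder_bound[OF uvH y(1), of 0] holder_spaceD(2)[OF uvH] by simp
    also have "\<dots> \<le> l * y powr \<alpha>" using uv y by (intro mult_mono) (use l in auto)
    finally show ?thesis by (simp add: u_def fun_scale_def)
  qed
  moreover have "(\<lambda>n. norm (z * smooth n power_fun y + v y)) \<longlonglongrightarrow> norm (z * power_fun y + v y)"
    by (intro tendsto_intros smooth_tendsto power_fun_holder y)
  ultimately have "norm (z * power_fun y + v y) \<le> l * y powr \<alpha>"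
    by (intro LIMSEQ_le_const2) blast+
  moreover have "z * power_fun y + v y = of_real (l * y powr \<alpha> / norm (v y) + 1) * v y"
    using y by (simp add: z_def power_fun_def algebra_simps)
  then have "norm (z * power_fun y + v y) = \<bar>l * y powr \<alpha> / norm (v y) + 1\<bar> * norm (v y)"
    by (simp only: norm_mult norm_of_real)
  moreover have "\<dots> = l * y powr \<alpha> + norm (v y)"
    using l vy by (simp add: abs_of_nonneg add_nonneg_nonneg distrib_right)
  ultimately show False using vy by simp
qed

lemma little_proper_M_ideal:
  "proper_M_ideal fun_scale (omega_holder_space \<alpha>) Lip
     (little_holder_space \<alpha> :: (real \<Rightarrow> 'k::{real_normed_field,banach}) set)"
  unfolding proper_M_ideal_def using little_M_ideal little_not_M_summand by blast

end

theorem theorem2p15: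
  fixes \<alpha> :: real
  assumes "0 < \<alpha>" and "\<alpha> < 1"
  shows "proper_M_ideal fun_scale (omega_holder_space \<alpha> :: (real \<Rightarrow> real) set)
           (holder_norm \<alpha>) (little_holder_space \<alpha>) \<and>
         proper_M_ideal fun_scale (omega_holder_space \<alpha> :: (real \<Rightarrow> complex) set)
           (holder_norm \<alpha>) (little_holder_space \<alpha>)"
proof -
  interpret holder_exponent \<alpha> using assms by unfold_locales
  show ?thesis by (intro conjI little_proper_M_ideal)
qed

end
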